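(* Let $\ell\ge1$ and let $\underline p_{\ell+1}\in\mathbb Z^{\ell+1}$ with $p_{\ell+1,1}\ge\cdots\ge p_{\ell+1,\ell+1}$. Let $\mathcal V$ be a representation of $\mathcal A^{(\ell)}$, $\mathcal V^*$ its dual, and let $|v_+\rangle\in\mathcal V$, $\langle v_-|\in\mathcal V^*$ satisfy $\langle v_-|v_+\rangle=1$ and $$T_{i,k}|v_+\rangle=|v_+\rangle,\qquad\langle v_-|X_{i,k}=\langle v_-|,\qquad i=1,\ldots,\ell,\ k=1,\ldots,i.$$ Then the normalized $q$-deformed $\mathfrak{gl}_{\ell+1}$-Whittaker function is the matrix element $$\widetilde\Psi^{\mathfrak{gl}_{\ell+1}}_{z_1,\ldots,z_{\ell+1}}(\underline p_{\ell+1})=\Big\langle v_-\Big|\ \prod_{k=1}^{\ell+1}f_{\ell+1,k}(\underline z;X_{n,i},T_{n,i})^{\,p_{\ell+1,k}-p_{\ell+1,k+1}}\ \Big|v_+\Big\rangle,$$ where $p_{\ell+1,\ell+2}:=0$.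
   Context: $0<q<1$; $(n)_q!=(1-q)\cdots(1-q^n)$, $(0)_q!=1$. $\mathcal A^{(\ell)}$ is the associative algebra (quantum torus) generated by $X_{k,i}^{\pm1},T_{k,i}^{\pm1}$, $1\le i\le k\le\ell$, with relations $T_{k,i}X_{m,j}=q^{\delta_{k,m}\delta_{i,j}}X_{m,j}T_{k,i}$, the $X$'s commuting among themselves and the $T$'s commuting among themselves. The elements $f_{n,i}\in\mathcal A^{(\ell)}[z_1,\ldots,z_{\ell+1}]$, $0\le i\le n\le\ell+1$, are defined recursively by $f_{n,0}=1$ (including $f_{0,0}=1$), $f_{n,n}=z_nf_{n-1,n-1}=z_1\cdots z_n$, and $$f_{n,i}=f_{n-1,i}X_{n-1,i}+z_n\,f_{n-1,i-1}T_{n-1,i},\qquad 1\le i<n.$$ The variables $z_i$ are central; $f_{\ell+1,\ell+1}=z_1\cdots z_{\ell+1}$ is a scalar and may be raised to negative powers (with $z_i\ne0$). The normalized $q$-deformed Whittaker function is $\widetilde\Psi^{\mathfrak{gl}_{\ell+1}}_z(\underline p_{\ell+1})=\prod_{k=1}^{\ell}(p_{\ell+1,k}-p_{\ell+1,k+1})_q!\ \Psi^{\mathfrak{gl}_{\ell+1}}_z(\underline p_{\ell+1})$, where for dominant $\underline p_{\ell+1}$ $$\Psi^{\mathfrak{gl}_{\ell+1}}_{z}(\underline p_{\ell+1})=\sum_{(p_{k,i})}\prod_{k=1}^{\ell+1}z_k^{\sum_i p_{k,i}-\sum_i p_{k-1,i}}\frac{\prod_{k=2}^{\ell}\prod_{i=1}^{k-1}(p_{k,i}-p_{k,i+1})_q!}{\prod_{k=1}^{\ell}\prod_{i=1}^{k}(p_{k+1,i}-p_{k,i})_q!\,(p_{k,i}-p_{k+1,i+1})_q!},$$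 the sum being over integers $p_{k,i}$, $1\le i\le k\le\ell$, with $p_{k+1,i}\ge p_{k,i}\ge p_{k+1,i+1}$, and $\sum_ip_{0,i}=0$. *)

theory Defs
  imports Complex_Main "HOL-Library.Poly_Mapping" "HOL-Algebra.QuotRing"
begin

section \<open>The quantum torus by generators and relations\<close>

text \<open>Lists form the free monoid under concatenation, so \<open>'a list \<Rightarrow>\<^sub>0 complex\<close>
  is the free associative unital algebra on \<open>'a\<close> with the convolution product of
  \<^theory>\<open>HOL-Library.Poly_Mapping\<close>.\<close>

instantiation list :: (type) monoid_add
begin

definition zero_list :: "'a list" where "zero_list = []"
definition plus_list :: "'a list \<Rightarrow> 'a list \<Rightarrow> 'a list" where "plus_list xs ys = xs @ ys"

instance
  by standard (simp_all add: zero_list_def plus_list_def)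

end

text \<open>The letters for $X_{k,i}$, $X_{k,i}^{-1}$, $T_{k,i}$, $T_{k,i}^{-1}$.\<close>

datatype qt_letter = LX nat nat | LXinv nat nat | LT nat nat | LTinv nat nat

type_synonym qt_word_alg = "qt_letter list \<Rightarrow>\<^sub>0 complex"

definition qt_index :: "nat \<Rightarrow> (nat \<times> nat) set" where
  "qt_index l = {(k, i). 1 \<le> i \<and> i \<le> k \<and> k \<le> l}"

definition qt_letters :: "nat \<Rightarrow> qt_letter set" where
  "qt_letters l = (\<Union>(k, i)\<in>qt_index l. {LX k i, LXinv k i, LT k i, LTinv k i})"

definition qt_free :: "nat \<Rightarrow> qt_word_alg ring" where
  "qt_free l = \<lparr>carrier = {f. \<forall>w\<in>Poly_Mapping.keys f. set w \<subseteq> qt_letters l},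
     mult = (*), one = 1, zero = 0, add = (+)\<rparr>"

abbreviation qt_word :: "qt_letter list \<Rightarrow> qt_word_alg" where
  "qt_word w \<equiv> Poly_Mapping.single w 1"

definition qt_relators :: "real \<Rightarrow> nat \<Rightarrow> qt_word_alg set" where
  "qt_relators q l =
     (\<Union>(k, i)\<in>qt_index l.
        {qt_word [LX k i, LXinv k i] - 1, qt_word [LXinv k i, LX k i] - 1,
         qt_word [LT k i, LTinv k i] - 1, qt_word [LTinv k i, LT k i] - 1}) \<union>
     (\<Union>(k, i)\<in>qt_index l. \<Union>(m, j)\<in>qt_index l.
        {qt_word [LT k i, LX m j]
           - Poly_Mapping.single [LX m j, LT k i]
               (of_real (q ^ (of_bool (k = m) * of_bool (i = j)))),
         qt_word [LX k i, LX m j] - qt_word [LX m j, LX k i],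
         qt_word [LT k i, LT m j] - qt_word [LT m j, LT k i]})"

text \<open>Ideals in \<^theory>\<open>HOL-Algebra.Ideal\<close> are two-sided.\<close>

definition qt_ideal :: "real \<Rightarrow> nat \<Rightarrow> qt_word_alg set" where
  "qt_ideal q l = Idl\<^bsub>qt_free l\<^esub> (qt_relators q l)"

definition qtorus :: "real \<Rightarrow> nat \<Rightarrow> qt_word_alg set ring" where
  "qtorus q l = qt_free l Quot qt_ideal q l"

definition qt_class :: "real \<Rightarrow> nat \<Rightarrow> qt_word_alg \<Rightarrow> qt_word_alg set" where
  "qt_class q l a = qt_ideal q l +>\<^bsub>qt_free l\<^esub> a"

definition qt_X :: "real \<Rightarrow> nat \<Rightarrow> nat \<Rightarrow> nat \<Rightarrow> qt_word_alg set" where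
  "qt_X q l k i = qt_class q l (qt_word [LX k i])"

definition qt_T :: "real \<Rightarrow> nat \<Rightarrow> nat \<Rightarrow> nat \<Rightarrow> qt_word_alg set" where
  "qt_T q l k i = qt_class q l (qt_word [LT k i])"

text \<open>The scalar $c \cdot 1$; multiplication by it is the complex algebra structure.\<close>

definition qt_scalar :: "real \<Rightarrow> nat \<Rightarrow> complex \<Rightarrow> qt_word_alg set" where
  "qt_scalar q l c = qt_class q l (Poly_Mapping.single [] c)"

lemma carrier_qt_free:
  "carrier (qt_free l) = {f. \<forall>w\<in>Poly_Mapping.keys f. set w \<subseteq> qt_letters l}"
  by (simp add: qt_free_def)

lemma qt_free_single_closed:
  "set w \<subseteq> qt_letters l \<Longrightarrow> Poly_Mapping.single w c \<in> carrier (qt_free l)"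
  by (simp add: carrier_qt_free)

lemma qt_free_one_closed: "1 \<in> carrier (qt_free l)"
  by (simp add: carrier_qt_free zero_list_def)

lemma qt_free_diff_closed:
  "a \<in> carrier (qt_free l) \<Longrightarrow> b \<in> carrier (qt_free l) \<Longrightarrow> a - b \<in> carrier (qt_free l)"
  using keys_diff[of a b] by (fastforce simp: carrier_qt_free)

lemma ring_qt_free: "ring (qt_free l)"
proof (rule ringI)
  show "abelian_group (qt_free l)"
  proof (rule abelian_groupI)
    fix a b assume "a \<in> carrier (qt_free l)" "b \<in> carrier (qt_free l)"
    then show "a \<oplus>\<^bsub>qt_free l\<^esub> b \<in> carrier (qt_free l)"
      using keys_add[of a b] by (auto simp: qt_free_def)
  next
    fix a assume "a \<in> carrier (qt_free l)"
    then have "- a \<in> carrier (qt_free l)"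
      by (auto simp: qt_free_def in_keys_iff)
    then show "\<exists>b\<in>carrier (qt_free l). b \<oplus>\<^bsub>qt_free l\<^esub> a = \<zero>\<^bsub>qt_free l\<^esub>"
      by (rule bexI[rotated]) (simp add: qt_free_def)
  qed (auto simp: qt_free_def algebra_simps)
  show "Group.monoid (qt_free l)"
  proof (rule monoidI)
    fix a b assume "a \<in> carrier (qt_free l)" "b \<in> carrier (qt_free l)"
    then show "a \<otimes>\<^bsub>qt_free l\<^esub> b \<in> carrier (qt_free l)"
      using keys_mult[of a b] by (fastforce simp: qt_free_def plus_list_def)
  qed (auto simp: qt_free_def zero_list_def mult.assoc)
qed (auto simp: qt_free_def distrib_left distrib_right)

lemma qt_letters_iff [simp]:
  "LX k i \<in> qt_letters l \<longleftrightarrow> (k, i) \<in> qt_index l"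
  "LXinv k i \<in> qt_letters l \<longleftrightarrow> (k, i) \<in> qt_index l"
  "LT k i \<in> qt_letters l \<longleftrightarrow> (k, i) \<in> qt_index l"
  "LTinv k i \<in> qt_letters l \<longleftrightarrow> (k, i) \<in> qt_index l"
  by (auto simp: qt_letters_def)

lemma qt_relators_subset: "qt_relators q l \<subseteq> carrier (qt_free l)"
  unfolding qt_relators_def
  by (auto intro!: qt_free_diff_closed qt_free_single_closed qt_free_one_closed)

lemma ideal_qt_ideal: "ideal (qt_ideal q l) (qt_free l)"
  unfolding qt_ideal_def by (rule ring.genideal_ideal[OF ring_qt_free qt_relators_subset])

lemma ring_qtorus: "ring (qtorus q l)"
  unfolding qtorus_def by (rule ideal.quotient_is_ring[OF ideal_qt_ideal])


section \<open>Representations\<close>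

definition End_ring :: "(complex \<Rightarrow> 'v::ab_group_add \<Rightarrow> 'v) \<Rightarrow> ('v \<Rightarrow> 'v) ring" where
  "End_ring scale = \<lparr>carrier = {f. Vector_Spaces.linear scale scale f},
     mult = (\<circ>), one = id, zero = (\<lambda>v. 0), add = (\<lambda>f g v. f v + g v)\<rparr>"

text \<open>A unital homomorphism of complex algebras into the endomorphisms of a vector space:
  a ring homomorphism is complex linear iff it maps $c \cdot 1$ to $c \cdot \mathrm{id}$.\<close>

definition qt_representation ::
  "real \<Rightarrow> nat \<Rightarrow> (complex \<Rightarrow> 'v::ab_group_add \<Rightarrow> 'v) \<Rightarrow> (qt_word_alg set \<Rightarrow> 'v \<Rightarrow> 'v) \<Rightarrow> bool"
  where
  "qt_representation q l scale \<rho> \<longleftrightarrow>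
     vector_space scale \<and> \<rho> \<in> ring_hom (qtorus q l) (End_ring scale) \<and>
     (\<forall>c. \<rho> (qt_scalar q l c) = scale c)"


section \<open>The elements $f_{n,i}$\<close>

text \<open>The central variables $z_i$ are specialised to complex numbers. The value for $i > n$
  is irrelevant.\<close>

fun qt_f :: "real \<Rightarrow> nat \<Rightarrow> (nat \<Rightarrow> complex) \<Rightarrow> nat \<Rightarrow> nat \<Rightarrow> qt_word_alg set" where
  "qt_f q l z n 0 = \<one>\<^bsub>qtorus q l\<^esub>"
| "qt_f q l z 0 (Suc i) = \<zero>\<^bsub>qtorus q l\<^esub>"
| "qt_f q l z (Suc n) (Suc i) =
     (if i = n then qt_scalar q l (z (Suc n)) \<otimes>\<^bsub>qtorus q l\<^esub> qt_f q l z n n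
      else if i < n then
        qt_f q l z n (Suc i) \<otimes>\<^bsub>qtorus q l\<^esub> qt_X q l n (Suc i)
        \<oplus>\<^bsub>qtorus q l\<^esub>
        qt_scalar q l (z (Suc n)) \<otimes>\<^bsub>qtorus q l\<^esub> qt_f q l z n i \<otimes>\<^bsub>qtorus q l\<^esub> qt_T q l n (Suc i)
      else \<zero>\<^bsub>qtorus q l\<^esub>)"

definition ordered_prod :: "('a, 'b) monoid_scheme \<Rightarrow> 'a list \<Rightarrow> 'a" where
  "ordered_prod G xs = foldr (\<lambda>x y. x \<otimes>\<^bsub>G\<^esub> y) xs \<one>\<^bsub>G\<^esub>"


section \<open>The $q$-deformed Whittaker function\<close>

text \<open>The $q$-factorial $(m)_q!$; the argument is an integer because it is only used on
  (nonnegative) differences of integers.\<close>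

definition qfact :: "real \<Rightarrow> int \<Rightarrow> real" where
  "qfact q m = (\<Prod>j=1..nat m. (1 - q ^ j))"

text \<open>Interlacing arrays $(p_{k,i})_{1 \le i \le k \le l+1}$ with top row $p$; entries outside
  the triangle are set to 0 so that each array is represented exactly once.\<close>

definition gt_patterns :: "nat \<Rightarrow> (nat \<Rightarrow> int) \<Rightarrow> (nat \<Rightarrow> nat \<Rightarrow> int) set" where
  "gt_patterns l p = {P.
     (\<forall>i\<in>{1..l+1}. P (l+1) i = p i) \<and>
     (\<forall>k\<in>{1..l}. \<forall>i\<in>{1..k}. P (k+1) i \<ge> P k i \<and> P k i \<ge> P (k+1) (i+1)) \<and>
     (\<forall>k i. (k, i) \<notin> qt_index (l+1) \<longrightarrow> P k i = 0)}"

definition q_whittaker :: "real \<Rightarrow> nat \<Rightarrow> (nat \<Rightarrow> complex) \<Rightarrow> (nat \<Rightarrow> int) \<Rightarrow> complex" where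
  "q_whittaker q l z p =
     (\<Sum>P\<in>gt_patterns l p.
        (\<Prod>k=1..l+1. z k powi ((\<Sum>i=1..k. P k i) - (\<Sum>i=1..k-1. P (k-1) i))) *
        of_real
          ((\<Prod>k=2..l. \<Prod>i=1..k-1. qfact q (P k i - P k (i+1))) /
           (\<Prod>k=1..l. \<Prod>i=1..k. qfact q (P (k+1) i - P k i) * qfact q (P k i - P (k+1) (i+1)))))"

definition q_whittaker_normalized ::
  "real \<Rightarrow> nat \<Rightarrow> (nat \<Rightarrow> complex) \<Rightarrow> (nat \<Rightarrow> int) \<Rightarrow> complex" where
  "q_whittaker_normalized q l z p =
     of_real (\<Prod>k=1..l. qfact q (p k - p (k+1))) * q_whittaker q l z p"

lemma gt_patterns_bounds:
  assumes "P \<in> gt_patterns l p" "d \<le> l" "1 \<le> i" "i \<le> l + 1 - d"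
  shows "Min (p ` {1..l+1}) \<le> P (l + 1 - d) i \<and> P (l + 1 - d) i \<le> Max (p ` {1..l+1})"
  using assms(2-)
proof (induction d arbitrary: i)
  case 0
  then have "P (l+1) i = p i" using assms(1) by (auto simp: gt_patterns_def)
  then show ?case using 0 by auto
next
  case (Suc d)
  define k where "k = l + 1 - Suc d"
  have k: "l + 1 - d = k + 1" "k \<in> {1..l}" "i \<in> {1..k}"
    using Suc.prems by (auto simp: k_def)
  have "P (k+1) i \<ge> P k i \<and> P k i \<ge> P (k+1) (i+1)"
    using assms(1) k(2,3) by (auto simp: gt_patterns_def)
  moreover have "P (k+1) i \<le> Max (p ` {1..l+1})"
    using Suc.IH[of i] Suc.prems k by auto
  moreover have "Min (p ` {1..l+1}) \<le> P (k+1) (i+1)"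
    using Suc.IH[of "i+1"] Suc.prems k by auto
  ultimately show ?case unfolding k_def[symmetric] by linarith
qed

text \<open>The sum defining \<^const>\<open>q_whittaker\<close> is finite (an infinite one would be 0 by
  convention).\<close>

lemma finite_gt_patterns: "finite (gt_patterns l p)"
proof -
  let ?I = "qt_index (l+1)"
  let ?B = "{Min (p ` {1..l+1})..Max (p ` {1..l+1})}"
  have fin_I: "finite ?I"
    by (rule finite_subset[of _ "{..l+1} \<times> {..l+1}"]) (auto simp: qt_index_def)
  have fin: "finite {f. (\<forall>x. (x \<in> ?I \<longrightarrow> f x \<in> ?B) \<and> (x \<notin> ?I \<longrightarrow> f x = (0::int)))}"
    by (rule finite_set_of_finite_funs[OF fin_I]) simp
  have "(\<lambda>P (k, i). P k i) ` gt_patterns l p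
      \<subseteq> {f. (\<forall>x. (x \<in> ?I \<longrightarrow> f x \<in> ?B) \<and> (x \<notin> ?I \<longrightarrow> f x = (0::int)))}"
  proof (clarsimp, intro conjI impI)
    fix P k i assume P: "P \<in> gt_patterns l p"
    { assume "(k, i) \<in> qt_index (Suc l)"
      then have ki: "1 \<le> i" "i \<le> k" "k \<le> l + 1" by (auto simp: qt_index_def)
      have "Min (p ` {1..l+1}) \<le> P k i \<and> P k i \<le> Max (p ` {1..l+1})"
        using gt_patterns_bounds[OF P, of "l + 1 - k" i] ki by auto
      then show "Min (p ` {Suc 0..Suc l}) \<le> P k i" "P k i \<le> Max (p ` {Suc 0..Suc l})"
        by auto }
    { assume "(k, i) \<notin> qt_index (Suc l)"
      then show "P k i = 0" using P by (auto simp: gt_patterns_def) }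
  qed
  then have "finite ((\<lambda>P (k, i). P k i) ` gt_patterns l p)"
    using fin by (rule finite_subset)
  moreover have "inj_on (\<lambda>P (k, i). P k i) (gt_patterns l p)"
    by (rule inj_onI) (metis (no_types, lifting) case_prod_conv ext)
  ultimately show ?thesis by (rule finite_imageD)
qed

end

theory Submission
  imports Defs
begin

text \<open>
  For fixed $n$ the elements $f_{n,1}, \dots, f_{n,n}$ commute, since $f_{n,i}$ involves row
  $n - 1$ of the generators only through $X_{n-1,i}$ and $T_{n-1,i}$. The two summands
  $A = f_{n-1,i} X_{n-1,i}$ and $B = z_n f_{n-1,i-1} T_{n-1,i}$ of $f_{n,i}$ satisfy $BA = q AB$, so
  the $q$-binomial theorem expands $f_{n,i}^{p_{n,i} - p_{n,i+1}}$ as a sum over $p_{n-1,i}$ between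
  $p_{n,i+1}$ and $p_{n,i}$. In a product over $i$ of such terms, the $X_{n-1,i}$ can be moved to the
  left vector and the $T_{n-1,i}$ to the right vector, where they act trivially; what remains is the
  matrix element of $\prod_i f_{n-1,i}^{p_{n-1,i} - p_{n-1,i+1}}$. Iterating over $n$ produces the
  sum over Gelfand--Tsetlin patterns, one row at a time.
\<close>

section \<open>Ordered products of commuting elements\<close>

text \<open>Powers of q enter only through the q-binomial coefficients. Each summand of an expanded
  power has X_{n-1,i} on its left and T_{n-1,i} on its right, and T_{n-1,i} commutes with X_{n-1,j}
  for distinct i and j. Hence a T and an X with the same indices never change places when the
  product is sorted. The surviving exponents depend on the new row alone: factor i contributes
  p_{n-1,i} - p_{n,i+1} to f_{n-1,i}, factor i+1 contributes p_{n,i+1} - p_{n-1,i+1}, and p_{n,i+1}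
  cancels. The diagonal element f_{n,n} is treated separately because its exponent p_{n,n} may be
  negative. It is the scalar z_1 ... z_n and is carried along as a prefactor. The binomial
  coefficients of a step have as numerators the factorials of the row above. The normalization of
  the Whittaker function supplies exactly those of the top row, which the defining sum does not
  contain.\<close>

definition commutes :: "'a::monoid_mult \<Rightarrow> 'a \<Rightarrow> bool" where
  "commutes a b \<longleftrightarrow> a * b = b * a"

lemma commutes_sym: "commutes a b \<Longrightarrow> commutes b a"
  by (simp add: commutes_def)

lemma commutes_refl [simp]: "commutes a a"
  by (simp add: commutes_def)

lemma commutes_one [simp]: "commutes a 1" "commutes 1 a"
  by (simp_all add: commutes_def)

lemma commutes_mult: "commutes a b \<Longrightarrow> commutes a c \<Longrightarrow> commutes a (b * c)"
  unfolding commutes_def by (metis mult.assoc)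

lemma commutes_mult_left: "commutes b a \<Longrightarrow> commutes c a \<Longrightarrow> commutes (b * c) a"
  by (meson commutes_mult commutes_sym)

lemma commutes_add:
  fixes a :: "'a::{ring,monoid_mult}"
  shows "commutes a b \<Longrightarrow> commutes a c \<Longrightarrow> commutes a (b + c)"
  by (simp add: commutes_def distrib_left distrib_right)

lemma commutes_power: "commutes a b \<Longrightarrow> commutes a (b ^ n)"
  by (induction n) (auto intro: commutes_mult)

lemma commutes_powers: "commutes a b \<Longrightarrow> commutes (a ^ m) (b ^ n)"
  by (meson commutes_power commutes_sym)

lemma commutes_prod_list: "(\<And>x. x \<in> set xs \<Longrightarrow> commutes a x) \<Longrightarrow> commutes a (prod_list xs)"
  by (induction xs) (auto intro: commutes_mult)

lemma commutes_power_mult: "commutes a b \<Longrightarrow> (a * b) ^ n = a ^ n * b ^ n"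
proof (induction n)
  case (Suc n)
  have "b * a ^ n = a ^ n * b"
    using commutes_power[OF commutes_sym[OF Suc.prems], of n] by (simp add: commutes_def)
  then show ?case
    using Suc by (simp add: mult.assoc) (metis mult.assoc)
qed simp

text \<open>\<open>t i\<close> and \<open>x i\<close> may fail to commute: within its own factor
  \<open>x i\<close> already stands to the left of \<open>t i\<close>, and sorting never exchanges
  these two. This keeps additional powers of q out.\<close>

lemma prod_list_triple_split:
  fixes x u t :: "'i \<Rightarrow> 'a::monoid_mult"
  assumes "distinct is"
    and ux: "\<And>i j. i \<in> set is \<Longrightarrow> j \<in> set is \<Longrightarrow> commutes (u i) (x j)"
    and tu: "\<And>i j. i \<in> set is \<Longrightarrow> j \<in> set is \<Longrightarrow> commutes (t i) (u j)"
    and tx: "\<And>i j. i \<in> set is \<Longrightarrow> j \<in> set is \<Longrightarrow> i \<noteq> j \<Longrightarrow> commutes (t i) (x j)"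
  shows "prod_list (map (\<lambda>i. x i * u i * t i) is) =
    prod_list (map x is) * prod_list (map u is) * prod_list (map t is)"
  using assms
proof (induction "is")
  case (Cons a "is")
  let ?X = "prod_list (map x is)" and ?U = "prod_list (map u is)" and ?T = "prod_list (map t is)"
  have uX: "u a * ?X = ?X * u a"
    using Cons.prems by (fold commutes_def) (auto intro!: commutes_prod_list)
  have "commutes (t a) (x j)" if "j \<in> set is" for j
    using Cons.prems(1) that by (intro Cons.prems(4)) auto
  then have tX: "t a * ?X = ?X * t a"
    by (fold commutes_def) (auto intro!: commutes_prod_list)
  have tU: "t a * ?U = ?U * t a"
    using Cons.prems by (fold commutes_def) (auto intro!: commutes_prod_list)
  have "prod_list (map (\<lambda>i. x i * u i * t i) (a # is)) = x a * u a * (t a * ?X) * ?U * ?T"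
    using Cons by (simp add: mult.assoc)
  also have "\<dots> = x a * (u a * ?X) * (t a * ?U) * ?T"
    by (simp only: tX mult.assoc)
  also have "\<dots> = x a * ?X * (u a * ?U) * (t a * ?T)"
    by (simp only: uX tU mult.assoc)
  finally show ?case by simp
qed simp

text \<open>The power of \<open>G i\<close> is collected from the neighbouring factors
  \<open>i\<close> and \<open>i + 1\<close>, so only consecutive elements have to commute.
  \<open>G 0 = 1\<close> removes the second half of the first factor; the last element has no right
  neighbour and keeps the exponent \<open>a (m + 1)\<close> alone.\<close>

lemma prod_list_telescope:
  fixes G :: "nat \<Rightarrow> 'a::monoid_mult"
  assumes "G 0 = 1" "\<And>j. commutes (G j) (G (Suc j))"
  shows "prod_list (map (\<lambda>i. G i ^ a i * G (i - 1) ^ b i) [1..<m + 2]) =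
    prod_list (map (\<lambda>i. G i ^ (a i + b (i + 1))) [1..<m + 1]) * G (m + 1) ^ a (m + 1)"
proof (induction m)
  case 0
  then show ?case using assms by simp
next
  case (Suc m)
  let ?P = "prod_list (map (\<lambda>i. G i ^ (a i + b (i + 1))) [1..<m + 1])"
  have "commutes (G (m + 2) ^ a (m + 2)) (G (m + 1) ^ b (m + 2))"
    using assms(2)[of "m + 1"] by (intro commutes_powers) (auto intro: commutes_sym)
  then have c: "G (m + 2) ^ a (m + 2) * G (m + 1) ^ b (m + 2) =
      G (m + 1) ^ b (m + 2) * G (m + 2) ^ a (m + 2)"
    by (simp add: commutes_def)
  have "prod_list (map (\<lambda>i. G i ^ a i * G (i - 1) ^ b i) [1..<Suc m + 2]) =
      prod_list (map (\<lambda>i. G i ^ a i * G (i - 1) ^ b i) [1..<m + 2]) *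
      (G (m + 2) ^ a (m + 2) * G (m + 1) ^ b (m + 2))"
    by (simp add: mult.assoc)
  also have "\<dots> = ?P * (G (m + 1) ^ a (m + 1) * G (m + 1) ^ b (m + 2)) * G (m + 2) ^ a (m + 2)"
    unfolding Suc.IH c by (simp only: mult.assoc)
  also have "\<dots> = prod_list (map (\<lambda>i. G i ^ (a i + b (i + 1))) [1..<Suc m + 1]) *
      G (Suc m + 1) ^ a (Suc m + 1)"
    by (simp add: power_add mult.assoc)
  finally show ?case .
qed

text \<open>Distributivity without commutativity: a choice function picks one summand from each
  factor, and the order of the list is kept.\<close>

lemma prod_list_sum_distrib:
  fixes g :: "'i \<Rightarrow> 'k \<Rightarrow> 'a::{semiring_0,monoid_mult}"
  assumes "distinct is"
  shows "prod_list (map (\<lambda>i. \<Sum>k\<in>S i. g i k) is) =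
    (\<Sum>h\<in>PiE (set is) S. prod_list (map (\<lambda>i. g i (h i)) is))"
  using assms
proof (induction "is")
  case (Cons a "is")
  let ?P = "PiE (set is) S"
  have a: "a \<notin> set is" using Cons.prems by simp
  have eq: "prod_list (map (\<lambda>i. g i ((h(a := k)) i)) is) = prod_list (map (\<lambda>i. g i (h i)) is)"
    for h k
    using a by (intro arg_cong[where f = prod_list] map_cong) auto
  have "(\<Sum>h\<in>PiE (set (a # is)) S. prod_list (map (\<lambda>i. g i (h i)) (a # is))) =
      (\<Sum>(k, h)\<in>S a \<times> ?P. prod_list (map (\<lambda>i. g i ((h(a := k)) i)) (a # is)))"
    unfolding list.set PiE_insert_eq sum.reindex[OF inj_combinator[OF a]]
    by (intro sum.cong) (auto simp: o_def)
  also have "\<dots> = (\<Sum>(k, h)\<in>S a \<times> ?P. g a k * prod_list (map (\<lambda>i. g i (h i)) is))"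
    by (simp only: list.map prod_list.Cons eq fun_upd_same)
  also have "\<dots> = (\<Sum>k\<in>S a. g a k) * (\<Sum>h\<in>?P. prod_list (map (\<lambda>i. g i (h i)) is))"
    by (simp add: sum_product sum.cartesian_product)
  finally show ?case using Cons by simp
qed simp


section \<open>The $q$-binomial theorem\<close>

lemma qfact_pos:
  assumes "0 < q" "q < 1"
  shows "qfact q m > 0"
  unfolding qfact_def using assms by (intro prod_pos) (auto simp: power_Suc_less_one power_less_one_iff)

lemma qfact_Suc: "qfact q (int (Suc n)) = qfact q (int n) * (1 - q ^ Suc n)"
  unfolding qfact_def nat_int by (simp add: mult.commute)

lemma qfact_0 [simp]: "qfact q 0 = 1"
  by (simp add: qfact_def)

definition qbinom :: "real \<Rightarrow> nat \<Rightarrow> nat \<Rightarrow> real" where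
  "qbinom q m k = qfact q (int m) / (qfact q (int k) * qfact q (int (m - k)))"

lemma qbinom_0 [simp]:
  assumes "0 < q" "q < 1"
  shows "qbinom q m 0 = 1"
  using qfact_pos[OF assms, of "int m"] by (simp add: qbinom_def)

lemma qbinom_self [simp]:
  assumes "0 < q" "q < 1"
  shows "qbinom q m m = 1"
  using qfact_pos[OF assms, of "int m"] by (simp add: qbinom_def)

text \<open>The identity \<open>1 - q ^ Suc m = (1 - q ^ Suc k) + q ^ Suc k * (1 - q ^ (m -
  k))\<close> over a common denominator. The boundary case \<open>k = m\<close> is left out, since
  truncated subtraction makes \<open>qbinom q m (Suc m)\<close> nonzero instead of 0.\<close>

lemma qbinom_Suc_Suc:
  assumes q: "0 < q" "q < 1" and "k < m"
  shows "qbinom q (Suc m) (Suc k) = qbinom q m k + q ^ Suc k * qbinom q m (Suc k)"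
proof -
  obtain d where m: "m = Suc (k + d)" using \<open>k < m\<close> less_iff_Suc_add by auto
  have "q ^ Suc n < 1" for n using q by (rule power_Suc_less_one)
  then have nz: "1 - q ^ Suc k \<noteq> 0" "1 - q ^ Suc d \<noteq> 0"
    by (smt (verit))+
  have pos: "qfact q (int n) \<noteq> 0" for n using qfact_pos[OF q, of "int n"] by simp
  have "1 - q ^ Suc m = (1 - q ^ Suc k) + q ^ Suc k * (1 - q ^ Suc d)"
    by (simp add: m power_add algebra_simps)
  then have *: "qbinom q (Suc m) (Suc k) =
      qfact q (int m) * ((1 - q ^ Suc k) + q ^ Suc k * (1 - q ^ Suc d)) /
      (qfact q (int k) * (1 - q ^ Suc k) * (qfact q (int d) * (1 - q ^ Suc d)))"
    by (simp only: qbinom_def qfact_Suc m diff_Suc_Suc) (simp only: add_Suc_right[symmetric] diff_add_inverse qfact_Suc)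
  have 1: "qbinom q m k = qfact q (int m) / (qfact q (int k) * (qfact q (int d) * (1 - q ^ Suc d)))"
    unfolding qbinom_def using m by (simp only: add_Suc_right[symmetric] diff_add_inverse qfact_Suc)
  have 2: "qbinom q m (Suc k) = qfact q (int m) / (qfact q (int k) * (1 - q ^ Suc k) * qfact q (int d))"
    unfolding qbinom_def using m by (simp only: diff_Suc_Suc diff_add_inverse qfact_Suc)
  define x y f g h where "x = 1 - q ^ Suc k" and "y = 1 - q ^ Suc d"
    and "f = qfact q (int k)" and "g = qfact q (int d)" and "h = qfact q (int m)"
  have nz': "x \<noteq> 0" "y \<noteq> 0" "f \<noteq> 0" "g \<noteq> 0" using nz pos by (auto simp: x_def y_def f_def g_def)
  show ?thesis unfolding * 1 2 x_def[symmetric] y_def[symmetric] f_def[symmetric] g_def[symmetric] h_def[symmetric]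
    using nz' by (simp add: field_simps del: power_Suc)
qed

text \<open>\<open>s c\<close> stands for the operator c times the identity. The target ring will
  consist of all additive maps, where such operators need not be central; commutation with scalars
  is therefore demanded element by element.\<close>

locale scalar_map =
  fixes s :: "complex \<Rightarrow> 'e::{ring,monoid_mult}"
  assumes s_add: "s (a + b) = s a + s b"
    and s_mult: "s (a * b) = s a * s b"
    and s_one [simp]: "s 1 = 1"
begin

lemma s_power: "s (a ^ n) = s a ^ n"
  by (induction n) (simp_all add: s_mult)

lemma s_commutes [simp]: "commutes (s a) (s b)"
  unfolding commutes_def s_mult[symmetric] by (simp add: mult.commute)

lemma prod_list_scalar:
  assumes "distinct is" "\<And>c i. i \<in> set is \<Longrightarrow> commutes (G i) (s c)"
  shows "prod_list (map (\<lambda>i. s (w i) * G i) is) = s (\<Prod>i\<in>set is. w i) * prod_list (map G is)"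
  using assms
proof (induction "is")
  case (Cons a "is")
  have "G a * s c = s c * G a" for c
    using Cons.prems(2)[of a c] by (simp add: commutes_def)
  then have "s (w a) * G a * (s c * P) = s (w a * c) * (G a * P)" for c P
    by (metis mult.assoc s_mult)
  then show ?case using Cons by simp
qed simp

text \<open>Multiplication by \<open>A + B\<close> from the left: \<open>A\<close> raises the index
  by one, while \<open>B\<close> passes \<open>A ^ k\<close> and picks up \<open>q ^ k\<close>. The
  coefficient of \<open>A ^ Suc k\<close> is then the q-Pascal sum. The two extreme terms are split
  off because the Pascal rule covers only the terms between them.\<close>

lemma q_binomial_nat:
  assumes q: "0 < q" "q < 1"
    and BA: "B * A = s (of_real q) * A * B"
    and A: "\<And>c. commutes (s c) A" and B: "\<And>c. commutes (s c) B"
  shows "(A + B) ^ m = (\<Sum>k\<le>m. s (of_real (qbinom q m k)) * A ^ k * B ^ (m - k))"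
proof (induction m)
  case 0
  then show ?case using q by simp
next
  case (Suc m)
  let ?c = "\<lambda>m k. s (of_real (qbinom q m k))"
  let ?M = "\<lambda>k. A ^ k * B ^ (Suc m - k)"
  have As: "A * s c = s c * A" and Bs: "B * s c = s c * B" for c
    using A[of c] B[of c] by (simp_all add: commutes_def)
  have BAk: "B * A ^ k = s (of_real (q ^ k)) * A ^ k * B" for k
  proof (induction k)
    case (Suc k)
    have "B * A ^ Suc k = (B * A) * A ^ k" by (simp add: mult.assoc)
    also have "\<dots> = s (of_real q) * A * (B * A ^ k)" by (simp only: BA mult.assoc)
    also have "\<dots> = s (of_real q) * (A * s (of_real (q ^ k))) * A ^ k * B"
      by (simp only: Suc mult.assoc)
    also have "\<dots> = s (of_real (q ^ Suc k)) * A ^ Suc k * B"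
      by (simp add: As s_mult mult.assoc)
    finally show ?case .
  qed simp
  have 1: "A * (?c m k * A ^ k * B ^ (m - k)) = ?c m k * ?M (Suc k)" for k
    by (simp add: mult.assoc[symmetric] As)
  have 2: "B * (?c m k * A ^ k * B ^ (m - k)) = s (of_real (q ^ k * qbinom q m k)) * ?M k"
    if "k \<le> m" for k
  proof -
    have "B * (?c m k * A ^ k * B ^ (m - k)) = ?c m k * (B * A ^ k) * B ^ (m - k)"
      by (simp add: mult.assoc[symmetric] Bs)
    also have "\<dots> = (?c m k * s (of_real (q ^ k))) * (A ^ k * (B * B ^ (m - k)))"
      by (simp only: BAk mult.assoc)
    also have "\<dots> = s (of_real (q ^ k * qbinom q m k)) * ?M k"
      using that by (simp add: s_mult[symmetric] mult.commute Suc_diff_le)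
    finally show ?thesis .
  qed
  have "(A + B) ^ Suc m =
      (\<Sum>k\<le>m. A * (?c m k * A ^ k * B ^ (m - k))) + (\<Sum>k\<le>m. B * (?c m k * A ^ k * B ^ (m - k)))"
    by (simp add: Suc distrib_right sum_distrib_left sum.distrib)
  also have "\<dots> = (\<Sum>k\<le>m. ?c m k * ?M (Suc k)) +
      (\<Sum>k\<le>m. s (of_real (q ^ k * qbinom q m k)) * ?M k)"
    using 1 2 by simp
  also have "(\<Sum>k\<le>m. ?c m k * ?M (Suc k)) = (\<Sum>k<m. ?c m k * ?M (Suc k)) + ?M (Suc m)"
    using q by (simp add: lessThan_Suc_atMost[symmetric])
  also have "(\<Sum>k\<le>m. s (of_real (q ^ k * qbinom q m k)) * ?M k) =
      ?M 0 + (\<Sum>k<m. s (of_real (q ^ Suc k * qbinom q m (Suc k))) * ?M (Suc k))"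
    using q by (simp add: sum.atMost_shift)
  also have "(\<Sum>k<m. ?c m k * ?M (Suc k)) + ?M (Suc m) +
      (?M 0 + (\<Sum>k<m. s (of_real (q ^ Suc k * qbinom q m (Suc k))) * ?M (Suc k))) =
      ?M 0 + (\<Sum>k<m. ?c (Suc m) (Suc k) * ?M (Suc k)) + ?M (Suc m)"
  proof -
    have "(\<Sum>k<m. ?c (Suc m) (Suc k) * ?M (Suc k)) = (\<Sum>k<m. ?c m k * ?M (Suc k)) +
      (\<Sum>k<m. s (of_real (q ^ Suc k * qbinom q m (Suc k))) * ?M (Suc k))"
      unfolding sum.distrib[symmetric]
    proof (rule sum.cong[OF refl])
      fix k assume "k \<in> {..<m}"
      then have "qbinom q (Suc m) (Suc k) = qbinom q m k + q ^ Suc k * qbinom q m (Suc k)"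
        by (intro qbinom_Suc_Suc q) auto
      then show "?c (Suc m) (Suc k) * ?M (Suc k) = ?c m k * ?M (Suc k) +
          s (of_real (q ^ Suc k * qbinom q m (Suc k))) * ?M (Suc k)"
        by (simp only: of_real_add s_add distrib_right)
    qed
    then show ?thesis by (simp only: add_ac)
  qed
  also have "\<dots> = (\<Sum>k\<le>Suc m. ?c (Suc m) k * ?M k)"
  proof -
    have "(\<Sum>k\<le>Suc m. ?c (Suc m) k * ?M k) =
        ?c (Suc m) 0 * ?M 0 + (\<Sum>k<Suc m. ?c (Suc m) (Suc k) * ?M (Suc k))"
      by (rule sum.atMost_shift)
    then show ?thesis using q by (simp add: add.assoc)
  qed
  finally show ?case by (simp only: mult.assoc)
qed

text \<open>The summation index is shifted to run from \<open>b\<close> to \<open>a\<close>, as an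
  entry of a pattern runs between its two neighbours in the row above.\<close>

lemma q_binomial:
  fixes a b :: int
  assumes q: "0 < q" "q < 1"
    and BA: "B * A = s (of_real q) * A * B"
    and A: "\<And>c. commutes (s c) A" and B: "\<And>c. commutes (s c) B"
    and "b \<le> a"
  shows "(A + B) ^ nat (a - b) =
    (\<Sum>k\<in>{b..a}. s (of_real (qfact q (a - b) / (qfact q (a - k) * qfact q (k - b)))) *
      A ^ nat (k - b) * B ^ nat (a - k))"
proof -
  have "(\<Sum>k\<le>nat (a - b). s (of_real (qbinom q (nat (a - b)) k)) * A ^ k * B ^ (nat (a - b) - k)) =
    (\<Sum>k\<in>{b..a}. s (of_real (qfact q (a - b) / (qfact q (a - k) * qfact q (k - b)))) *
      A ^ nat (k - b) * B ^ nat (a - k))"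
  proof (rule sum.reindex_bij_witness[of _ "\<lambda>k. nat (k - b)" "\<lambda>k. int k + b"])
    fix k assume "k \<in> {..nat (a - b)}"
    then have "int (nat (a - b) - k) = a - (int k + b)" "nat (a - b) - k = nat (a - (int k + b))"
      "int (nat (a - b)) = a - b" using \<open>b \<le> a\<close> by auto
    then show "s (of_real (qfact q (a - b) / (qfact q (a - (int k + b)) * qfact q (int k + b - b)))) *
        A ^ nat (int k + b - b) * B ^ nat (a - (int k + b)) =
      s (of_real (qbinom q (nat (a - b)) k)) * A ^ k * B ^ (nat (a - b) - k)"
      by (simp add: qbinom_def mult.commute)
  qed (use \<open>b \<le> a\<close> in auto)
  then show ?thesis unfolding q_binomial_nat[OF q BA A B] .
qed

end

section \<open>The elements $f_{n,i}$ and their powers\<close>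

text \<open>The functional \<open>\<phi>\<close> models the matrix element between the two vectors:
  an X on the far left and a T on the far right are absorbed. The range \<open>n \<le> l\<close> in
  the recursion reaches row \<open>l + 1\<close> of \<open>F\<close>, which uses the generators of
  row \<open>l\<close>.\<close>

locale whittaker_data = scalar_map s
  for s :: "complex \<Rightarrow> 'e::{ring,monoid_mult}" +
  fixes q :: real and l :: nat and z :: "nat \<Rightarrow> complex"
    and X T F :: "nat \<Rightarrow> nat \<Rightarrow> 'e" and \<phi> :: "'e \<Rightarrow> complex"
  assumes q: "0 < q" "q < 1"
    and s_X: "(k, i) \<in> qt_index l \<Longrightarrow> commutes (s c) (X k i)"
    and s_T: "(k, i) \<in> qt_index l \<Longrightarrow> commutes (s c) (T k i)"
    and XX: "(k, i) \<in> qt_index l \<Longrightarrow> (m, j) \<in> qt_index l \<Longrightarrow> commutes (X k i) (X m j)"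
    and TT: "(k, i) \<in> qt_index l \<Longrightarrow> (m, j) \<in> qt_index l \<Longrightarrow> commutes (T k i) (T m j)"
    and TX: "(k, i) \<in> qt_index l \<Longrightarrow> (m, j) \<in> qt_index l \<Longrightarrow> (k, i) \<noteq> (m, j) \<Longrightarrow>
      commutes (T k i) (X m j)"
    and TX_same: "(k, i) \<in> qt_index l \<Longrightarrow> T k i * X k i = s (of_real q) * X k i * T k i"
    and F_0 [simp]: "F n 0 = 1"
    and F_diag: "n \<le> l \<Longrightarrow> F (Suc n) (Suc n) = s (z (Suc n)) * F n n"
    and F_step: "n \<le> l \<Longrightarrow> 1 \<le> i \<Longrightarrow> i \<le> n \<Longrightarrow>
      F (Suc n) i = F n i * X n i + s (z (Suc n)) * F n (i - 1) * T n i"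
    and \<phi>_add: "\<phi> (a + b) = \<phi> a + \<phi> b"
    and \<phi>_s: "\<phi> (s c * a) = c * \<phi> a"
    and \<phi>_X: "(k, i) \<in> qt_index l \<Longrightarrow> \<phi> (X k i * a) = \<phi> a"
    and \<phi>_T: "(k, i) \<in> qt_index l \<Longrightarrow> \<phi> (a * T k i) = \<phi> a"
    and \<phi>_1 [simp]: "\<phi> 1 = 1"
begin

lemma \<phi>_sum: "finite A \<Longrightarrow> \<phi> (\<Sum>a\<in>A. f a) = (\<Sum>a\<in>A. \<phi> (f a))"
proof (induction A rule: finite_induct)
  case empty
  show ?case using \<phi>_add[of 0 0] by simp
qed (simp add: \<phi>_add)

lemma \<phi>_X_power: "(k, i) \<in> qt_index l \<Longrightarrow> \<phi> (X k i ^ n * a) = \<phi> a"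
  by (induction n arbitrary: a) (simp_all add: \<phi>_X mult.assoc)

lemma \<phi>_T_power: "(k, i) \<in> qt_index l \<Longrightarrow> \<phi> (a * T k i ^ n) = \<phi> a"
  by (induction n arbitrary: a) (simp_all add: \<phi>_T mult.assoc[symmetric])

lemma \<phi>_X_prod_list:
  "(\<And>i. i \<in> set is \<Longrightarrow> (k, i) \<in> qt_index l) \<Longrightarrow>
    \<phi> (prod_list (map (\<lambda>i. X k i ^ e i) is) * a) = \<phi> a"
  by (induction "is" arbitrary: a) (simp_all add: \<phi>_X_power mult.assoc)

lemma \<phi>_T_prod_list:
  "(\<And>i. i \<in> set is \<Longrightarrow> (k, i) \<in> qt_index l) \<Longrightarrow>
    \<phi> (a * prod_list (map (\<lambda>i. T k i ^ e i) is)) = \<phi> a"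
  by (induction "is" arbitrary: a) (simp_all add: \<phi>_T_power mult.assoc[symmetric])

text \<open>Unfolding the recursion, \<open>F n i\<close> is a polynomial in scalars and the
  generators of rows below \<open>n\<close>, so commuting with these is enough.\<close>

lemma commutes_F:
  assumes "n \<le> Suc l" "i \<le> n"
    and "\<And>c. commutes a (s c)"
    and "\<And>m j. m < n \<Longrightarrow> (m, j) \<in> qt_index l \<Longrightarrow> commutes a (X m j)"
    and "\<And>m j. m < n \<Longrightarrow> (m, j) \<in> qt_index l \<Longrightarrow> commutes a (T m j)"
  shows "commutes a (F n i)"
  using assms
proof (induction n arbitrary: i)
  case (Suc n)
  have IH: "commutes a (F n j)" if "j \<le> n" for j
    using Suc.prems that by (intro Suc.IH) auto
  consider "i = 0" | "i = Suc n" | "1 \<le> i" "i \<le> n" using Suc.prems by linarith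
  then show ?case
  proof cases
    case 3
    then have "(n, i) \<in> qt_index l" using Suc.prems by (auto simp: qt_index_def)
    then show ?thesis
      unfolding F_step[OF Suc.prems(1)[unfolded Suc_le_mono] 3]
      using 3 Suc.prems by (intro commutes_add commutes_mult IH) auto
  qed (use Suc.prems IH in \<open>auto simp: F_diag intro!: commutes_mult\<close>)
qed simp

lemma s_F: "n \<le> Suc l \<Longrightarrow> i \<le> n \<Longrightarrow> commutes (s c) (F n i)"
  by (intro commutes_F s_X s_T) auto

lemma X_F: "n \<le> Suc l \<Longrightarrow> i \<le> n \<Longrightarrow> n \<le> k \<Longrightarrow> (k, j) \<in> qt_index l \<Longrightarrow> commutes (X k j) (F n i)"
  by (intro commutes_F XX commutes_sym[OF s_X] commutes_sym[OF TX]) auto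

lemma T_F: "n \<le> Suc l \<Longrightarrow> i \<le> n \<Longrightarrow> n \<le> k \<Longrightarrow> (k, j) \<in> qt_index l \<Longrightarrow> commutes (T k j) (F n i)"
  by (intro commutes_F TT commutes_sym[OF s_T] TX) auto

text \<open>Distinct elements of row \<open>n + 1\<close> involve distinct generators of row
  \<open>n\<close>, and all other ingredients commute by induction. The case \<open>i = j\<close> is
  separated because \<open>T n i\<close> and \<open>X n i\<close> only q-commute.\<close>

lemma F_F:
  assumes "n \<le> Suc l" "i \<le> n" "j \<le> n"
  shows "commutes (F n i) (F n j)"
  using assms
proof (induction n arbitrary: i j)
  case (Suc n)
  have n: "n \<le> l" using Suc.prems by simp
  have IH: "commutes (F n i) (F n j)" if "i \<le> n" "j \<le> n" for i j
    using Suc.prems that by (intro Suc.IH) auto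
  have diag: "commutes a (F (Suc n) (Suc n))"
    if "\<And>c. commutes a (s c)" "commutes a (F n n)" for a
    unfolding F_diag[OF n] by (intro commutes_mult that)
  have s: "commutes (F (Suc n) i) (s c)" if "i \<le> Suc n" for i c
    by (intro commutes_sym[OF s_F] Suc.prems that)
  \<comment> \<open>The recursion expresses one of the two elements through row \<open>n\<close>, so
    row \<open>n + 1\<close> must first be shown to commute with row \<open>n\<close>.\<close>
  have step: "commutes (F (Suc n) i) (F n j)" if i: "i \<le> Suc n" and j: "j \<le> n" for i j
  proof -
    consider "i = 0" | "i = Suc n" | "1 \<le> i" "i \<le> n" using i by linarith
    then show ?thesis
    proof cases
      case 2
      then show ?thesis unfolding 2 using n j
        by (intro commutes_sym[OF diag] IH commutes_sym[OF s_F]) auto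
    next
      case 3
      then have "(n, i) \<in> qt_index l" using n by (auto simp: qt_index_def)
      then show ?thesis unfolding F_step[OF n 3] using n j 3
        by (intro commutes_sym[of "F n j"] commutes_add commutes_mult IH
            commutes_sym[OF X_F] commutes_sym[OF T_F] commutes_sym[OF s_F]) auto
    qed simp
  qed
  consider "i = j" | "i = 0" | "j = 0" | "j = Suc n" "i \<le> Suc n" | "i = Suc n" "j \<le> Suc n"
    | "1 \<le> i" "i \<le> n" "1 \<le> j" "j \<le> n" "i \<noteq> j" using Suc.prems by linarith
  then show ?case
  proof cases
    case 4
    then show ?thesis by (metis diag s step order_refl)
  next
    case 5
    then show ?thesis by (metis commutes_sym diag s step order_refl)
  next
    case 6
    have ij: "(n, i) \<in> qt_index l" "(n, j) \<in> qt_index l"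
      using n 6 by (auto simp: qt_index_def)
    have X: "commutes (X n j) (F (Suc n) i)"
      unfolding F_step[OF n 6(1,2)] using n 6 ij
      by (intro commutes_add commutes_mult XX X_F commutes_sym[OF TX] commutes_sym[OF s_X]) auto
    have T: "commutes (T n j) (F (Suc n) i)"
      unfolding F_step[OF n 6(1,2)] using n 6 ij
      by (intro commutes_add commutes_mult TT TX T_F commutes_sym[OF s_T]) auto
    show ?thesis unfolding F_step[OF n 6(3,4)] using 6
      by (intro commutes_add commutes_mult step s commutes_sym[OF X] commutes_sym[OF T]) auto
  qed auto
qed simp

lemma F_diag_eq: "n \<le> Suc l \<Longrightarrow> F n n = s (\<Prod>k=1..n. z k)"
  by (induction n) (simp_all add: F_diag s_mult[symmetric] mult.commute)

end

text \<open>The q-binomial coefficient of \<open>a - b\<close> over \<open>k - b\<close>, where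
  \<open>a\<close> and \<open>b\<close> are neighbours in a row and \<open>k\<close> is the entry
  between them in the next lower row.\<close>

definition gt_coeff :: "real \<Rightarrow> int \<Rightarrow> int \<Rightarrow> int \<Rightarrow> real" where
  "gt_coeff q a b k = qfact q (a - b) / (qfact q (a - k) * qfact q (k - b))"

text \<open>Rows are extensional here, in agreement with the choice functions of
  \<open>prod_list_sum_distrib\<close>, whereas patterns are 0 outside the triangle; the passage
  between the two needs \<open>restrict\<close>.\<close>

definition interlacing :: "nat \<Rightarrow> (nat \<Rightarrow> int) \<Rightarrow> (nat \<Rightarrow> int) set" where
  "interlacing m p = PiE {1..m} (\<lambda>i. {p (i + 1)..p i})"

lemma finite_interlacing: "finite (interlacing m p)"
  unfolding interlacing_def by (intro finite_PiE) auto

section \<open>Reduction of the matrix element by one row\<close>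

context whittaker_data
begin

lemma F_power:
  fixes a b :: int
  assumes i: "1 \<le> i" "i \<le> m" "m \<le> l" and "b \<le> a"
  shows "F (Suc m) i ^ nat (a - b) =
    (\<Sum>k\<in>{b..a}. X m i ^ nat (k - b) *
      (s (of_real (gt_coeff q a b k) * z (Suc m) ^ nat (a - k)) *
        (F m i ^ nat (k - b) * F m (i - 1) ^ nat (a - k))) * T m i ^ nat (a - k))"
proof -
  have I: "(m, i) \<in> qt_index l" using i by (simp add: qt_index_def)
  let ?f = "F m i" and ?g = "F m (i - 1)" and ?x = "X m i" and ?t = "T m i"
    and ?A = "F m i * X m i" and ?Z = "s (z (Suc m))"
  let ?B = "?Z * ?g * ?t"
  have sf: "commutes (s c) ?f" and sg: "commutes (s c) ?g" and sx: "commutes (s c) ?x"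
    and st: "commutes (s c) ?t" for c
    using i by (auto intro!: s_F s_X[OF I] s_T[OF I])
  have xf: "commutes ?x ?f" and xg: "commutes ?x ?g" and tf: "commutes ?t ?f" and tg: "commutes ?t ?g"
    using i by (auto intro!: X_F[OF _ _ _ I] T_F[OF _ _ _ I])
  have gf: "commutes ?g ?f" using i by (intro F_F) auto
  have fZg: "commutes (?Z * ?g) ?f" "commutes (?Z * ?g) ?x" "commutes (?Z * ?g) (s c)" for c
    using gf sf sg sx xg by (auto intro!: commutes_mult_left intro: commutes_sym)
  \<comment> \<open>All factors commute except \<open>T m i\<close> with \<open>X m i\<close>; this
    single exchange produces the q.\<close>
  have BA: "?B * ?A = s (of_real q) * ?A * ?B"
  proof -
    have "?B * ?A = ?Z * ?g * (?t * ?f) * ?x" by (simp only: mult.assoc)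
    also have "\<dots> = (?Z * ?g * ?f) * (?t * ?x)" using tf by (simp only: commutes_def mult.assoc)
    also have "\<dots> = ?f * ((?Z * ?g) * s (of_real q)) * ?x * ?t"
      using fZg(1) by (simp only: TX_same[OF I] commutes_def mult.assoc)
    also have "\<dots> = (?f * s (of_real q)) * ((?Z * ?g) * ?x) * ?t"
      using fZg(3) by (simp only: commutes_def mult.assoc)
    also have "\<dots> = s (of_real q) * ?f * ?x * (?Z * ?g) * ?t"
      using sf[of "of_real q"] fZg(2) by (simp only: commutes_def mult.assoc)
    finally show ?thesis by (simp only: mult.assoc)
  qed
  have sA: "commutes (s c) ?A" and sB: "commutes (s c) ?B" for c
    by (intro commutes_mult sf sg sx st s_commutes)+
  have A: "?A ^ n = ?x ^ n * ?f ^ n" for n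
    using commutes_power_mult[OF xf] xf by (simp add: commutes_def)
  have B: "?B ^ n = s (z (Suc m) ^ n) * ?g ^ n * ?t ^ n" for n
    using sg st tg by (subst commutes_power_mult; (subst commutes_power_mult)?)
      (auto simp: s_power intro!: commutes_mult_left intro: commutes_sym)
  \<comment> \<open>\<open>X m i\<close> is brought to the far left and \<open>T m i\<close> to the
    far right, the form that \<open>prod_list_triple_split\<close> expects.\<close>
  have summand: "s c * ?A ^ u * ?B ^ v =
      ?x ^ u * (s (c * z (Suc m) ^ v) * (?f ^ u * ?g ^ v)) * ?t ^ v" for c u v
  proof -
    have 1: "s c * ?x ^ u = ?x ^ u * s c" "?f ^ u * s d = s d * ?f ^ u" for d
      using commutes_power[OF sx[of c], of u] commutes_power[OF sf[of d], of u]
      by (simp_all add: commutes_def)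
    have "s c * ?A ^ u * ?B ^ v = (s c * ?x ^ u) * (?f ^ u * s (z (Suc m) ^ v)) * ?g ^ v * ?t ^ v"
      unfolding A B by (simp only: mult.assoc)
    also have "\<dots> = ?x ^ u * (s c * s (z (Suc m) ^ v)) * ?f ^ u * ?g ^ v * ?t ^ v"
      by (simp only: 1 mult.assoc)
    finally show ?thesis by (simp only: s_mult mult.assoc)
  qed
  show ?thesis
    unfolding F_step[OF \<open>m \<le> l\<close> i(1,2)] q_binomial[OF q BA sA sB \<open>b \<le> a\<close>] summand gt_coeff_def ..
qed

text \<open>The list stops before \<open>n\<close>: the diagonal element is a scalar whose exponent
  may be negative, so it is kept outside the monomial. For a dominant row the remaining exponents
  are nonnegative, hence \<open>nat\<close>.\<close>

definition F_monomial :: "nat \<Rightarrow> (nat \<Rightarrow> int) \<Rightarrow> 'e" where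
  "F_monomial n p = prod_list (map (\<lambda>i. F n i ^ nat (p i - p (i + 1))) [1..<n])"

lemma F_monomial_step:
  assumes m: "m = Suc n" "m \<le> l" and h: "\<And>i. i \<in> {1..m} \<Longrightarrow> p (i + 1) \<le> h i \<and> h i \<le> p i"
  shows "prod_list (map (\<lambda>i. F m i ^ nat (h i - p (i + 1)) * F m (i - 1) ^ nat (p i - h i)) [1..<m + 1]) =
    F_monomial m h * F m m ^ nat (h m - p (m + 1))"
proof -
  \<comment> \<open>\<open>G\<close> is 1 beyond \<open>m\<close>, where nothing is known about
    \<open>F m i\<close>, because the telescoping lemma asks for commutation at every index.\<close>
  define G where "G i = (if i \<le> m then F m i else 1)" for i
  have "prod_list (map (\<lambda>i. F m i ^ nat (h i - p (i + 1)) * F m (i - 1) ^ nat (p i - h i)) [1..<m + 1]) =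
      prod_list (map (\<lambda>i. G i ^ nat (h i - p (i + 1)) * G (i - 1) ^ nat (p i - h i)) [1..<n + 2])"
    by (intro arg_cong[where f = prod_list] map_cong) (auto simp: G_def m)
  also have "\<dots> = prod_list (map (\<lambda>i. G i ^ (nat (h i - p (i + 1)) + nat (p (i + 1) - h (i + 1)))) [1..<n + 1]) *
      G (n + 1) ^ nat (h (n + 1) - p (n + 1 + 1))"
    by (rule prod_list_telescope) (use m in \<open>auto simp: G_def intro!: F_F\<close>)
  also have "prod_list (map (\<lambda>i. G i ^ (nat (h i - p (i + 1)) + nat (p (i + 1) - h (i + 1)))) [1..<n + 1]) =
      F_monomial m h"
    unfolding F_monomial_def
  proof (intro arg_cong[where f = prod_list] map_cong)
    fix i assume i: "i \<in> set [1..<m]"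
    \<comment> \<open>Interlacing makes both differences nonnegative, so \<open>nat\<close> is
      additive here and \<open>p (i + 1)\<close> cancels.\<close>
    then have "nat (h i - p (i + 1)) + nat (p (i + 1) - h (i + 1)) = nat (h i - h (i + 1))"
      using h[of i] h[of "i + 1"] by (auto simp flip: nat_add_distrib)
    then show "G i ^ (nat (h i - p (i + 1)) + nat (p (i + 1) - h (i + 1))) = F m i ^ nat (h i - h (i + 1))"
      using i by (simp add: G_def)
  qed (simp add: m)
  finally show ?thesis by (simp add: G_def m)
qed

text \<open>The exponent of \<open>z (Suc m)\<close> is the total decrease from \<open>p\<close> to
  \<open>h\<close>, one T for each unit. The power of z_1 ... z_m is the value of the diagonal
  factor \<open>F m m\<close> left over by the telescoping.\<close>

lemma \<phi>_F_monomial: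
  assumes m: "m = Suc n" "m \<le> l" and p: "\<And>i. i \<in> {1..m} \<Longrightarrow> p (i + 1) \<le> p i"
  shows "\<phi> (F_monomial (Suc m) p) = (\<Sum>h\<in>interlacing m p.
    of_real (\<Prod>i=1..m. gt_coeff q (p i) (p (i + 1)) (h i)) *
    z (Suc m) ^ nat (\<Sum>i=1..m. p i - h i) *
    (\<Prod>k=1..m. z k) ^ nat (h m - p (m + 1)) * \<phi> (F_monomial m h))"
proof -
  let ?is = "[1..<m + 1]"
  have set_is: "set ?is = {1..m}" by auto
  let ?x = "\<lambda>h i. X m i ^ nat (h i - p (i + 1))"
  let ?t = "\<lambda>h i. T m i ^ nat (p i - h i)"
  let ?w = "\<lambda>h i. of_real (gt_coeff q (p i) (p (i + 1)) (h i)) * z (Suc m) ^ nat (p i - h i)"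
  let ?G = "\<lambda>h i. F m i ^ nat (h i - p (i + 1)) * F m (i - 1) ^ nat (p i - h i)"
  have I: "(m, i) \<in> qt_index l" if "i \<in> {1..m}" for i
    using that m by (simp add: qt_index_def)
  have summand: "\<phi> (prod_list (map (\<lambda>i. ?x h i * (s (?w h i) * ?G h i) * ?t h i) ?is)) =
      of_real (\<Prod>i=1..m. gt_coeff q (p i) (p (i + 1)) (h i)) *
      z (Suc m) ^ nat (\<Sum>i=1..m. p i - h i) *
      (\<Prod>k=1..m. z k) ^ nat (h m - p (m + 1)) * \<phi> (F_monomial m h)"
    if "h \<in> interlacing m p" for h
  proof -
    have h: "p (i + 1) \<le> h i \<and> h i \<le> p i" if "i \<in> {1..m}" for i
      using \<open>h \<in> interlacing m p\<close> that by (auto simp: interlacing_def PiE_iff)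
    have sG: "commutes (s c) (?G h i)" if "i \<in> {1..m}" for c i
      using that m by (intro commutes_mult commutes_power s_F) auto
    \<comment> \<open>Applied to both generators \<open>X m i\<close> and \<open>T m i\<close>, each
      of which commutes with scalars and with row \<open>m\<close> of \<open>F\<close>.\<close>
    have a_u: "commutes (a ^ e) (s c * ?G h j)"
      if "commutes (s c) a" "\<And>i. i \<le> m \<Longrightarrow> commutes a (F m i)" "j \<in> {1..m}" for a e c j
      using that
      by (intro commutes_mult commutes_powers commutes_sym[OF commutes_power[of "s c"]]) auto
    have "prod_list (map (\<lambda>i. ?x h i * (s (?w h i) * ?G h i) * ?t h i) ?is) =
        prod_list (map (?x h) ?is) * prod_list (map (\<lambda>i. s (?w h i) * ?G h i) ?is) *
        prod_list (map (?t h) ?is)"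
    proof (rule prod_list_triple_split)
      fix i j assume "i \<in> set ?is" "j \<in> set ?is"
      then have ij: "i \<in> {1..m}" "j \<in> {1..m}" by auto
      show "commutes (s (?w h i) * ?G h i) (?x h j)"
        using ij m by (intro commutes_sym[OF a_u] s_X X_F I) auto
      show "commutes (?t h i) (s (?w h j) * ?G h j)"
        using ij m by (intro a_u s_T T_F I) auto
      show "commutes (?t h i) (?x h j)" if "i \<noteq> j"
        using ij that by (intro commutes_powers TX I) auto
    qed simp
    then have "\<phi> (prod_list (map (\<lambda>i. ?x h i * (s (?w h i) * ?G h i) * ?t h i) ?is)) =
        \<phi> (prod_list (map (?x h) ?is) * prod_list (map (\<lambda>i. s (?w h i) * ?G h i) ?is))"
      by (simp only:) (rule \<phi>_T_prod_list, use I in auto)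
    also have "\<dots> = \<phi> (prod_list (map (\<lambda>i. s (?w h i) * ?G h i) ?is))"
      by (rule \<phi>_X_prod_list) (use I in auto)
    also have "\<dots> = \<phi> (s (\<Prod>i=1..m. ?w h i) * prod_list (map (?G h) ?is))"
      by (subst prod_list_scalar) (auto simp only: set_is distinct_upt intro: commutes_sym[OF sG])
    also have "\<dots> = (\<Prod>i=1..m. ?w h i) * \<phi> (F_monomial m h * F m m ^ nat (h m - p (m + 1)))"
      by (simp only: \<phi>_s) (subst F_monomial_step[where p = p and h = h and n = n], use m h in auto)
    also have "F_monomial m h * F m m ^ nat (h m - p (m + 1)) =
        s ((\<Prod>k=1..m. z k) ^ nat (h m - p (m + 1))) * F_monomial m h"
    proof -
      have "commutes (s c) (F_monomial m h)" for c
        unfolding F_monomial_def using m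
        by (intro commutes_prod_list) (auto intro!: commutes_power s_F)
      then show ?thesis using m by (simp add: F_diag_eq s_power[symmetric] commutes_def)
    qed
    also have "(\<Prod>i=1..m. ?w h i) = of_real (\<Prod>i=1..m. gt_coeff q (p i) (p (i + 1)) (h i)) *
        z (Suc m) ^ nat (\<Sum>i=1..m. p i - h i)"
    proof -
      have "int (\<Sum>i=1..m. nat (p i - h i)) = (\<Sum>i=1..m. p i - h i)"
        unfolding of_nat_sum by (rule sum.cong) (use h in auto)
      then have "(\<Sum>i=1..m. nat (p i - h i)) = nat (\<Sum>i=1..m. p i - h i)"
        by linarith
      then have "(\<Prod>i=1..m. z (Suc m) ^ nat (p i - h i)) = z (Suc m) ^ nat (\<Sum>i=1..m. p i - h i)"
        by (simp only: power_sum[symmetric])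
      then show ?thesis by (simp add: prod.distrib)
    qed
    finally show ?thesis by (simp only: \<phi>_s mult.assoc)
  qed
  have "F_monomial (Suc m) p = prod_list (map (\<lambda>i. \<Sum>k\<in>{p (i + 1)..p i}.
      X m i ^ nat (k - p (i + 1)) *
      (s (of_real (gt_coeff q (p i) (p (i + 1)) k) * z (Suc m) ^ nat (p i - k)) *
        (F m i ^ nat (k - p (i + 1)) * F m (i - 1) ^ nat (p i - k))) * T m i ^ nat (p i - k)) ?is)"
    unfolding F_monomial_def Suc_eq_plus1[symmetric]
    by (intro arg_cong[where f = prod_list] map_cong F_power) (use m p in auto)
  also have "\<dots> = (\<Sum>h\<in>interlacing m p. prod_list (map (\<lambda>i. ?x h i * (s (?w h i) * ?G h i) * ?t h i) ?is))"
    unfolding interlacing_def set_is[symmetric] by (rule prod_list_sum_distrib) simp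
  finally have "F_monomial (Suc m) p = \<dots>" .
  then show ?thesis
    by (simp only: \<phi>_sum[OF finite_interlacing]) (rule sum.cong[OF refl summand])
qed

end

section \<open>Summation over Gelfand--Tsetlin patterns\<close>

text \<open>A pattern is its top row together with a smaller pattern whose own top row interlaces
  with it. \<open>top_row\<close> cuts \<open>p\<close> off outside the triangle, where patterns
  must vanish but \<open>p\<close> is arbitrary.\<close>

lemma sum_gt_patterns_Suc:
  fixes f :: "(nat \<Rightarrow> nat \<Rightarrow> int) \<Rightarrow> complex" and p :: "nat \<Rightarrow> int" and n :: nat
  defines "top_row \<equiv> (\<lambda>i. if i \<in> {1..n + 2} then p i else 0)"
  shows "(\<Sum>P\<in>gt_patterns (Suc n) p. f P) =
    (\<Sum>h\<in>interlacing (Suc n) p. \<Sum>Q\<in>gt_patterns n h. f (Q(n + 2 := top_row)))"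
proof -
  let ?S = "Sigma (interlacing (Suc n) p) (gt_patterns n)"
  have idx: "(k, i) \<in> qt_index (Suc n + 1) \<longleftrightarrow> (k, i) \<in> qt_index (n + 1) \<or> k = n + 2 \<and> i \<in> {1..n + 2}"
    for k i by (auto simp: qt_index_def)
  have "(\<Sum>P\<in>gt_patterns (Suc n) p. f P) = (\<Sum>(h, Q)\<in>?S. f (Q(n + 2 := top_row)))"
  \<comment> \<open>The inverse map reads off the second row, made extensional by
    \<open>restrict\<close>, and erases the top row, since a smaller pattern is 0 there.\<close>
  proof (rule sum.reindex_bij_witness[of _ "\<lambda>(h, Q). Q(n + 2 := top_row)"
        "\<lambda>P. (restrict (P (n + 1)) {1..n + 1}, P(n + 2 := (\<lambda>_. 0)))"])
    fix P assume P: "P \<in> gt_patterns (Suc n) p"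
    have top: "P (n + 2) = top_row"
    proof
      fix i
      have "P (n + 2) i = p i" if "i \<in> {1..n + 2}"
        using P that by (simp add: gt_patterns_def)
      moreover have "P (n + 2) i = 0" if "i \<notin> {1..n + 2}"
      proof -
        have "(n + 2, i) \<notin> qt_index (Suc n + 1)" using that by (auto simp: qt_index_def)
        then show ?thesis using P by (simp add: gt_patterns_def)
      qed
      ultimately show "P (n + 2) i = top_row i" by (simp add: top_row_def)
    qed
    then show "(case (restrict (P (n + 1)) {1..n + 1}, P(n + 2 := (\<lambda>_. 0))) of
        (h, Q) \<Rightarrow> Q(n + 2 := top_row)) = P" by auto
    then show "(case (restrict (P (n + 1)) {1..n + 1}, P(n + 2 := (\<lambda>_. 0))) of
        (h, Q) \<Rightarrow> f (Q(n + 2 := top_row))) = f P" by simp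
    have il: "P (k + 1) i \<ge> P k i \<and> P k i \<ge> P (k + 1) (i + 1)" if "k \<in> {1..Suc n}" "i \<in> {1..k}" for k i
      using P that unfolding gt_patterns_def by blast
    have "p (i + 1) \<le> P (n + 1) i \<and> P (n + 1) i \<le> p i" if "i \<in> {1..n + 1}" for i
      using il[of "n + 1" i] that top by (auto simp: top_row_def)
    then have "restrict (P (n + 1)) {1..n + 1} \<in> interlacing (Suc n) p"
      by (auto simp: interlacing_def)
    moreover have "P(n + 2 := (\<lambda>_. 0)) \<in> gt_patterns n (restrict (P (n + 1)) {1..n + 1})"
    proof -
      have "(P(n + 2 := (\<lambda>_. 0))) k i = 0" if "(k, i) \<notin> qt_index (n + 1)" for k i
        using P that idx[of k i] unfolding gt_patterns_def by (cases "k = n + 2") auto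
      moreover have "(P(n + 2 := (\<lambda>_. 0))) (k + 1) i \<ge> (P(n + 2 := (\<lambda>_. 0))) k i \<and>
          (P(n + 2 := (\<lambda>_. 0))) k i \<ge> (P(n + 2 := (\<lambda>_. 0))) (k + 1) (i + 1)"
        if "k \<in> {1..n}" "i \<in> {1..k}" for k i
        using il[of k i] that by auto
      ultimately show ?thesis by (simp add: gt_patterns_def)
    qed
    ultimately show "(restrict (P (n + 1)) {1..n + 1}, P(n + 2 := (\<lambda>_. 0))) \<in> ?S" by blast
  next
    fix x assume "x \<in> ?S"
    then obtain h Q where x: "x = (h, Q)" and h: "h \<in> interlacing (Suc n) p"
      and Q: "Q \<in> gt_patterns n h" by auto
    have Qh: "Q (n + 1) i = h i" if "i \<in> {1..n + 1}" for i
      using Q that unfolding gt_patterns_def by blast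
    have Q0: "Q k i = 0" if "(k, i) \<notin> qt_index (n + 1)" for k i
      using Q that unfolding gt_patterns_def by blast
    have il: "Q (k + 1) i \<ge> Q k i \<and> Q k i \<ge> Q (k + 1) (i + 1)" if "k \<in> {1..n}" "i \<in> {1..k}" for k i
      using Q that unfolding gt_patterns_def by blast
    have hp: "h i \<in> {p (i + 1)..p i}" if "i \<in> {1..n + 1}" for i
      using h that by (auto simp: interlacing_def PiE_iff)
    have "restrict (Q (n + 1)) {1..n + 1} = h"
      using Qh h by (auto simp: interlacing_def PiE_iff restrict_def extensional_def)
    moreover have "Q (n + 2) = (\<lambda>_. 0)"
      using Q0 by (auto simp: qt_index_def)
    ultimately show "(\<lambda>P. (restrict (P (n + 1)) {1..n + 1}, P(n + 2 := (\<lambda>_. 0))))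
        (case x of (h, Q) \<Rightarrow> Q(n + 2 := top_row)) = x"
      by (auto simp: x)
    let ?P = "Q(n + 2 := top_row)"
    have "?P (k + 1) i \<ge> ?P k i \<and> ?P k i \<ge> ?P (k + 1) (i + 1)" if "k \<in> {1..Suc n}" "i \<in> {1..k}" for k i
    proof (cases "k = n + 1")
      case True
      then show ?thesis using that hp[of i] Qh[of i] by (simp add: top_row_def)
    next
      case False
      then show ?thesis using that il[of k i] by auto
    qed
    moreover have "?P k i = 0" if "(k, i) \<notin> qt_index (Suc n + 1)" for k i
      using that idx[of k i] Q0[of k i] by (auto simp: top_row_def)
    ultimately show "(case x of (h, Q) \<Rightarrow> Q(n + 2 := top_row)) \<in> gt_patterns (Suc n) p"
      by (simp add: x gt_patterns_def top_row_def)
  qed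
  also have "\<dots> = (\<Sum>h\<in>interlacing (Suc n) p. \<Sum>Q\<in>gt_patterns n h. f (Q(n + 2 := top_row)))"
    by (rule sum.Sigma[symmetric]) (auto simp: finite_interlacing finite_gt_patterns)
  finally show ?thesis .
qed

lemma gt_patterns_0: "gt_patterns 0 p = {\<lambda>k i. if k = 1 \<and> i = 1 then p 1 else 0}"
proof -
  have idx: "(k, i) \<in> qt_index 1 \<longleftrightarrow> k = 1 \<and> i = 1" for k i
    by (auto simp: qt_index_def)
  show ?thesis
    by (auto simp: gt_patterns_def idx simp flip: One_nat_def intro!: ext)
qed

text \<open>The summand of the normalized Whittaker function, with its factorials regrouped into one
  q-binomial coefficient for each entry below the top row.\<close>

definition gt_weight :: "real \<Rightarrow> (nat \<Rightarrow> complex) \<Rightarrow> nat \<Rightarrow> (nat \<Rightarrow> nat \<Rightarrow> int) \<Rightarrow> complex" where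
  "gt_weight q z m P =
    (\<Prod>k=1..m+1. z k powi ((\<Sum>i=1..k. P k i) - (\<Sum>i=1..k-1. P (k-1) i))) *
    of_real (\<Prod>k=1..m. \<Prod>i=1..k. gt_coeff q (P (k+1) i) (P (k+1) (i+1)) (P k i))"

lemma gt_weight_Suc:
  assumes Q: "Q \<in> gt_patterns n h"
  shows "gt_weight q z (Suc n) (Q(n + 2 := (\<lambda>i. if i \<in> {1..n + 2} then p i else 0))) =
    z (n + 2) powi ((\<Sum>i=1..n+2. p i) - (\<Sum>i=1..n+1. h i)) *
    of_real (\<Prod>i=1..n+1. gt_coeff q (p i) (p (i + 1)) (h i)) * gt_weight q z n Q"
proof -
  have Qh: "Q (n + 1) i = h i" if "i \<in> {1..n + 1}" for i
    using Q that unfolding gt_patterns_def by blast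
  define P where "P = Q(n + 2 := (\<lambda>i. if i \<in> {1..n + 2} then p i else 0))"
  have PQ: "P k = Q k" if "k \<le> n + 1" for k using that by (simp add: P_def)
  have Pp: "P (n + 2) i = p i" if "i \<in> {1..n + 2}" for i using that by (simp add: P_def)
  have Ph: "P (n + 1) i = h i" if "i \<in> {1..n + 1}" for i using that Qh by (simp add: PQ)
  have "(\<Prod>k=1..Suc n+1. z k powi ((\<Sum>i=1..k. P k i) - (\<Sum>i=1..k-1. P (k-1) i))) =
      (\<Prod>k=1..n+1. z k powi ((\<Sum>i=1..k. P k i) - (\<Sum>i=1..k-1. P (k-1) i))) *
      z (n + 2) powi ((\<Sum>i=1..n+2. P (n + 2) i) - (\<Sum>i=1..n+1. P (n + 1) i))"
    by simp
  also have "(\<Prod>k=1..n+1. z k powi ((\<Sum>i=1..k. P k i) - (\<Sum>i=1..k-1. P (k-1) i))) =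
      (\<Prod>k=1..n+1. z k powi ((\<Sum>i=1..k. Q k i) - (\<Sum>i=1..k-1. Q (k-1) i)))"
    by (rule prod.cong) (auto simp: PQ)
  also have "(\<Sum>i=1..n+2. P (n + 2) i) = (\<Sum>i=1..n+2. p i)"
    by (rule sum.cong[OF refl Pp])
  also have "(\<Sum>i=1..n+1. P (n + 1) i) = (\<Sum>i=1..n+1. h i)"
    by (rule sum.cong[OF refl Ph])
  finally have 1: "(\<Prod>k=1..Suc n+1. z k powi ((\<Sum>i=1..k. P k i) - (\<Sum>i=1..k-1. P (k-1) i))) =
      (\<Prod>k=1..n+1. z k powi ((\<Sum>i=1..k. Q k i) - (\<Sum>i=1..k-1. Q (k-1) i))) *
      z (n + 2) powi ((\<Sum>i=1..n+2. p i) - (\<Sum>i=1..n+1. h i))" .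
  have "(\<Prod>k=1..Suc n. \<Prod>i=1..k. gt_coeff q (P (k+1) i) (P (k+1) (i+1)) (P k i)) =
      (\<Prod>k=1..n. \<Prod>i=1..k. gt_coeff q (P (k+1) i) (P (k+1) (i+1)) (P k i)) *
      (\<Prod>i=1..n+1. gt_coeff q (P (n + 2) i) (P (n + 2) (i+1)) (P (n + 1) i))"
    by simp
  also have "(\<Prod>k=1..n. \<Prod>i=1..k. gt_coeff q (P (k+1) i) (P (k+1) (i+1)) (P k i)) =
      (\<Prod>k=1..n. \<Prod>i=1..k. gt_coeff q (Q (k+1) i) (Q (k+1) (i+1)) (Q k i))"
    by (intro prod.cong) (simp_all add: PQ)
  also have "(\<Prod>i=1..n+1. gt_coeff q (P (n + 2) i) (P (n + 2) (i+1)) (P (n + 1) i)) =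
      (\<Prod>i=1..n+1. gt_coeff q (p i) (p (i + 1)) (h i))"
  proof (intro prod.cong refl)
    fix i assume "i \<in> {1..n + 1}"
    then have "i \<in> {1..n + 1}" "i \<in> {1..n + 2}" "i + 1 \<in> {1..n + 2}" by auto
    then show "gt_coeff q (P (n + 2) i) (P (n + 2) (i+1)) (P (n + 1) i) =
        gt_coeff q (p i) (p (i + 1)) (h i)" by (simp only: Pp Ph)
  qed
  finally have 2: "(\<Prod>k=1..Suc n. \<Prod>i=1..k. gt_coeff q (P (k+1) i) (P (k+1) (i+1)) (P k i)) =
      (\<Prod>k=1..n. \<Prod>i=1..k. gt_coeff q (Q (k+1) i) (Q (k+1) (i+1)) (Q k i)) *
      (\<Prod>i=1..n+1. gt_coeff q (p i) (p (i + 1)) (h i))" .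
  show ?thesis unfolding gt_weight_def P_def[symmetric] 1 2 of_real_mult by (simp only: mult_ac)
qed

text \<open>The coefficients \<open>gt_coeff\<close> of row \<open>k\<close> carry the numerators of
  row \<open>k + 1\<close>, so those of rows 2 to \<open>l + 1\<close> occur. The defining sum has
  rows 2 to \<open>l\<close>, and the normalization is the contribution of row
  \<open>l + 1\<close>.\<close>

lemma q_whittaker_normalized_eq:
  assumes "0 < q" "q < 1" "l \<ge> 1"
  shows "q_whittaker_normalized q l z p = (\<Sum>P\<in>gt_patterns l p. gt_weight q z l P)"
proof -
  have "of_real (\<Prod>k=1..l. qfact q (p k - p (k+1))) *
      ((\<Prod>k=1..l+1. z k powi ((\<Sum>i=1..k. P k i) - (\<Sum>i=1..k-1. P (k-1) i))) *
        of_real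
          ((\<Prod>k=2..l. \<Prod>i=1..k-1. qfact q (P k i - P k (i+1))) /
           (\<Prod>k=1..l. \<Prod>i=1..k. qfact q (P (k+1) i - P k i) * qfact q (P k i - P (k+1) (i+1))))) =
      gt_weight q z l P" if P: "P \<in> gt_patterns l p" for P
  proof -
    have Pp: "P (l + 1) i = p i" if "i \<in> {1..l + 1}" for i
      using P that unfolding gt_patterns_def by blast
    let ?g = "\<lambda>k. \<Prod>i=1..k-1. qfact q (P k i - P k (i+1))"
    have top: "?g (l + 1) = (\<Prod>k=1..l. qfact q (p k - p (k+1)))"
      using Pp by (intro prod.cong) auto
    have "(\<Prod>k=1..l. \<Prod>i=1..k. qfact q (P (k+1) i - P (k+1) (i+1))) = (\<Prod>k=1..l. ?g (k + 1))"
      by simp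
    also have "\<dots> = (\<Prod>k=2..l+1. ?g k)"
      by (subst prod.shift_bounds_cl_nat_ivl[symmetric]) (simp add: numeral_2_eq_2)
    also have "\<dots> = ?g (l + 1) * (\<Prod>k=2..l. ?g k)"
      using assms(3) by (simp add: mult.commute)
    finally show ?thesis
      unfolding gt_weight_def gt_coeff_def prod_dividef top of_real_mult of_real_divide
      by (simp only: times_divide_eq_right mult_ac of_real_mult)
  qed
  then show ?thesis
    unfolding q_whittaker_normalized_def q_whittaker_def sum_distrib_left by (intro sum.cong) auto
qed

section \<open>Induction over the rows of a pattern\<close>

context whittaker_data
begin

text \<open>The prefactor is the diagonal element raised to the last entry of the row, the factor
  that \<open>F_monomial\<close> omits. The induction keeps \<open>p\<close> arbitrary because each
  step passes to all rows \<open>h\<close> below it.\<close>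

theorem matrix_element_F_monomial:
  assumes "m \<le> l" "\<And>i. i \<in> {1..m} \<Longrightarrow> p (i + 1) \<le> p i" "\<And>k. k \<in> {1..m + 1} \<Longrightarrow> z k \<noteq> 0"
  shows "(\<Prod>k=1..m+1. z k) powi p (m + 1) * \<phi> (F_monomial (m + 1) p) =
    (\<Sum>P\<in>gt_patterns m p. gt_weight q z m P)"
  using assms
proof (induction m arbitrary: p)
  case 0
  show ?case by (simp add: F_monomial_def gt_patterns_0 gt_weight_def)
next
  case (Suc n p)
  let ?Z = "\<Prod>k=1..n+1. z k" and ?z = "z (n + 2)"
  let ?C = "\<lambda>h. complex_of_real (\<Prod>i=1..n+1. gt_coeff q (p i) (p (i + 1)) (h i))"
  have nz: "?Z \<noteq> 0" "?z \<noteq> 0" using Suc.prems(3) by auto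
  have "(\<Sum>P\<in>gt_patterns (Suc n) p. gt_weight q z (Suc n) P) =
      (\<Sum>h\<in>interlacing (Suc n) p. ?z powi ((\<Sum>i=1..n+2. p i) - (\<Sum>i=1..n+1. h i)) * ?C h *
        (\<Sum>Q\<in>gt_patterns n h. gt_weight q z n Q))"
    unfolding sum_gt_patterns_Suc sum_distrib_left
    by (intro sum.cong refl gt_weight_Suc)
  also have "\<dots> = (\<Sum>h\<in>interlacing (Suc n) p. (?Z * ?z) powi p (n + 2) * (?C h *
      ?z ^ nat (\<Sum>i=1..n+1. p i - h i) * ?Z ^ nat (h (n + 1) - p (n + 2)) * \<phi> (F_monomial (n + 1) h)))"
  proof (rule sum.cong[OF refl])
    fix h assume "h \<in> interlacing (Suc n) p"
    then have h: "p (i + 1) \<le> h i \<and> h i \<le> p i" if "i \<in> {1..n + 1}" for i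
      using that by (auto simp: interlacing_def PiE_iff)
    \<comment> \<open>Neighbouring entries of \<open>h\<close> are separated by
      \<open>p (i + 1)\<close>, so \<open>h\<close> is dominant again.\<close>
    have "h (i + 1) \<le> h i" if "i \<in> {1..n}" for i
      using h[of i] h[of "i + 1"] that by auto
    then have IH: "(\<Sum>Q\<in>gt_patterns n h. gt_weight q z n Q) = ?Z powi h (n + 1) * \<phi> (F_monomial (n + 1) h)"
      using Suc.prems by (intro Suc.IH[symmetric]) auto
    \<comment> \<open>The prefactor \<open>(?Z * ?z) powi p (n + 2)\<close> is shared out: its
      \<open>?z\<close> part completes the exponent to the difference of the full row sums, and its
      \<open>?Z\<close> part turns \<open>h (n + 1) - p (n + 2)\<close> into
      \<open>h (n + 1)\<close>, the prefactor of the induction hypothesis.\<close>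
    have "(\<Sum>i=1..n+1. p i - h i) \<ge> 0" using h by (intro sum_nonneg) auto
    then have "?z ^ nat (\<Sum>i=1..n+1. p i - h i) = ?z powi (\<Sum>i=1..n+1. p i - h i)"
      by (simp add: power_int_def)
    also have "\<dots> * ?z powi p (n + 2) = ?z powi ((\<Sum>i=1..n+2. p i) - (\<Sum>i=1..n+1. h i))"
      using nz by (simp add: power_int_add[symmetric] sum_subtractf algebra_simps)
    finally have 1: "?z ^ nat (\<Sum>i=1..n+1. p i - h i) * ?z powi p (n + 2) = \<dots>" .
    have "?Z ^ nat (h (n + 1) - p (n + 2)) = ?Z powi (h (n + 1) - p (n + 2))"
      using h[of "n + 1"] by (simp add: power_int_def)
    also have "\<dots> * ?Z powi p (n + 2) = ?Z powi h (n + 1)"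
      using nz by (simp only: power_int_add[symmetric] simp_thms) simp
    finally have 2: "?Z ^ nat (h (n + 1) - p (n + 2)) * ?Z powi p (n + 2) = \<dots>" .
    show "?z powi ((\<Sum>i=1..n+2. p i) - (\<Sum>i=1..n+1. h i)) * ?C h *
        (\<Sum>Q\<in>gt_patterns n h. gt_weight q z n Q) =
      (?Z * ?z) powi p (n + 2) * (?C h * ?z ^ nat (\<Sum>i=1..n+1. p i - h i) *
        ?Z ^ nat (h (n + 1) - p (n + 2)) * \<phi> (F_monomial (n + 1) h))"
      unfolding IH 1[symmetric] 2[symmetric] power_int_mult_distrib by (simp only: mult_ac)
  qed
  also have "\<dots> = (\<Prod>k=1..Suc n+1. z k) powi p (Suc n + 1) * \<phi> (F_monomial (Suc n + 1) p)"
    using Suc.prems \<phi>_F_monomial[of "Suc n" n p] by (simp add: sum_distrib_left)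
  finally show ?case ..
qed

end

section \<open>Computations in the quantum torus\<close>

lemma qt_class_hom: "qt_class q l \<in> ring_hom (qt_free l) (qtorus q l)"
proof -
  have "qt_class q l = (+>\<^bsub>qt_free l\<^esub>) (qt_ideal q l)"
    by (rule ext) (simp add: qt_class_def)
  then show ?thesis
    using ideal.rcos_ring_hom[OF ideal_qt_ideal[of q l]] by (simp add: qtorus_def)
qed

lemma qt_class_closed: "a \<in> carrier (qt_free l) \<Longrightarrow> qt_class q l a \<in> carrier (qtorus q l)"
  by (rule ring_hom_closed[OF qt_class_hom])

lemma qt_class_mult_single:
  assumes "set u \<subseteq> qt_letters l" "set v \<subseteq> qt_letters l"
  shows "qt_class q l (Poly_Mapping.single u c) \<otimes>\<^bsub>qtorus q l\<^esub> qt_class q l (Poly_Mapping.single v d) =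
    qt_class q l (Poly_Mapping.single (u @ v) (c * d))"
proof -
  have "Poly_Mapping.single u c \<otimes>\<^bsub>qt_free l\<^esub> Poly_Mapping.single v d =
      Poly_Mapping.single (u @ v) (c * d)"
    by (simp add: qt_free_def mult_single plus_list_def)
  then show ?thesis
    using ring_hom_mult[OF qt_class_hom qt_free_single_closed qt_free_single_closed] assms by metis
qed

text \<open>A relator lies in the ideal it helps to generate, so its class is zero. The commutation
  relations below are obtained in this way.\<close>

lemma qt_class_eqI:
  assumes "a - b \<in> qt_relators q l" "b \<in> carrier (qt_free l)"
  shows "qt_class q l a = qt_class q l b"
proof -
  interpret I: ideal "qt_ideal q l" "qt_free l" by (rule ideal_qt_ideal)
  interpret Q: ring "qtorus q l" by (rule ring_qtorus)
  have I: "a - b \<in> qt_ideal q l"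
    unfolding qt_ideal_def using assms(1) I.genideal_self[OF qt_relators_subset] by blast
  then have c: "a - b \<in> carrier (qt_free l)" by (rule I.a_Hcarr)
  have zero: "qt_class q l (a - b) = \<zero>\<^bsub>qtorus q l\<^esub>"
    using I.a_rcos_const[OF I] by (simp add: qt_class_def qtorus_def FactRing_def)
  have "a = (a - b) \<oplus>\<^bsub>qt_free l\<^esub> b" by (simp add: qt_free_def)
  then have "qt_class q l a = qt_class q l (a - b) \<oplus>\<^bsub>qtorus q l\<^esub> qt_class q l b"
    using ring_hom_add[OF qt_class_hom c assms(2)] by metis
  then show ?thesis using zero qt_class_closed[OF assms(2)] by simp
qed

lemma qt_X_closed: "(k, i) \<in> qt_index l \<Longrightarrow> qt_X q l k i \<in> carrier (qtorus q l)"
  and qt_T_closed: "(k, i) \<in> qt_index l \<Longrightarrow> qt_T q l k i \<in> carrier (qtorus q l)"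
  and qt_scalar_closed: "qt_scalar q l c \<in> carrier (qtorus q l)"
  unfolding qt_X_def qt_T_def qt_scalar_def
  by (auto intro!: qt_class_closed qt_free_single_closed)

lemma qt_X_commute:
  assumes "(k, i) \<in> qt_index l" "(m, j) \<in> qt_index l"
  shows "qt_X q l k i \<otimes>\<^bsub>qtorus q l\<^esub> qt_X q l m j = qt_X q l m j \<otimes>\<^bsub>qtorus q l\<^esub> qt_X q l k i"
proof -
  have "qt_class q l (qt_word [LX k i, LX m j]) = qt_class q l (qt_word [LX m j, LX k i])"
    using assms by (intro qt_class_eqI qt_free_single_closed) (auto simp: qt_relators_def)
  then show ?thesis using assms by (simp add: qt_X_def qt_class_mult_single)
qed

lemma qt_T_commute:
  assumes "(k, i) \<in> qt_index l" "(m, j) \<in> qt_index l"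
  shows "qt_T q l k i \<otimes>\<^bsub>qtorus q l\<^esub> qt_T q l m j = qt_T q l m j \<otimes>\<^bsub>qtorus q l\<^esub> qt_T q l k i"
proof -
  have "qt_class q l (qt_word [LT k i, LT m j]) = qt_class q l (qt_word [LT m j, LT k i])"
    using assms by (intro qt_class_eqI qt_free_single_closed) (auto simp: qt_relators_def)
  then show ?thesis using assms by (simp add: qt_T_def qt_class_mult_single)
qed

lemma qt_T_X:
  assumes "(k, i) \<in> qt_index l" "(m, j) \<in> qt_index l"
  shows "qt_T q l k i \<otimes>\<^bsub>qtorus q l\<^esub> qt_X q l m j =
    qt_scalar q l (of_real (q ^ (of_bool (k = m) * of_bool (i = j)))) \<otimes>\<^bsub>qtorus q l\<^esub>
      qt_X q l m j \<otimes>\<^bsub>qtorus q l\<^esub> qt_T q l k i"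
proof -
  have "qt_class q l (qt_word [LT k i, LX m j]) = qt_class q l (Poly_Mapping.single [LX m j, LT k i]
      (of_real (q ^ (of_bool (k = m) * of_bool (i = j)))))"
  proof (rule qt_class_eqI)
    show "qt_word [LT k i, LX m j] - Poly_Mapping.single [LX m j, LT k i]
        (of_real (q ^ (of_bool (k = m) * of_bool (i = j)))) \<in> qt_relators q l"
      unfolding qt_relators_def
      by (rule UnI2, rule UN_I[OF assms(1)], simp only: prod.case,
          rule UN_I[OF assms(2)], simp only: prod.case, blast)
  qed (rule qt_free_single_closed, use assms in simp)
  then show ?thesis using assms by (simp add: qt_T_def qt_X_def qt_scalar_def qt_class_mult_single)
qed

lemma qt_scalar_X: "(k, i) \<in> qt_index l \<Longrightarrow>
    qt_scalar q l c \<otimes>\<^bsub>qtorus q l\<^esub> qt_X q l k i = qt_X q l k i \<otimes>\<^bsub>qtorus q l\<^esub> qt_scalar q l c"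
  by (simp add: qt_X_def qt_scalar_def qt_class_mult_single)

lemma qt_scalar_T: "(k, i) \<in> qt_index l \<Longrightarrow>
    qt_scalar q l c \<otimes>\<^bsub>qtorus q l\<^esub> qt_T q l k i = qt_T q l k i \<otimes>\<^bsub>qtorus q l\<^esub> qt_scalar q l c"
  by (simp add: qt_T_def qt_scalar_def qt_class_mult_single)

lemma qt_scalar_mult:
  "qt_scalar q l c \<otimes>\<^bsub>qtorus q l\<^esub> qt_scalar q l d = qt_scalar q l (c * d)"
  by (simp add: qt_scalar_def qt_class_mult_single)

lemma qt_scalar_one: "qt_scalar q l 1 = \<one>\<^bsub>qtorus q l\<^esub>"
proof -
  have "qt_scalar q l 1 = qt_class q l \<one>\<^bsub>qt_free l\<^esub>"
    by (simp add: qt_scalar_def qt_free_def single_one[symmetric] zero_list_def del: single_one)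
  then show ?thesis using ring_hom_one[OF qt_class_hom] by metis
qed

lemma qt_scalar_nat_pow: "qt_scalar q l c [^]\<^bsub>qtorus q l\<^esub> (n::nat) = qt_scalar q l (c ^ n)"
  by (induction n) (simp_all add: qt_scalar_one qt_scalar_mult mult.commute)

text \<open>The inverse of a nonzero scalar is the scalar of the inverse. This evaluates the
  possibly negative power of the diagonal element.\<close>

lemma qt_scalar_int_pow:
  assumes "c \<noteq> 0"
  shows "qt_scalar q l c [^]\<^bsub>qtorus q l\<^esub> (e::int) = qt_scalar q l (c powi e)"
proof -
  interpret Q: ring "qtorus q l" by (rule ring_qtorus)
  have "inv\<^bsub>qtorus q l\<^esub> qt_scalar q l d = qt_scalar q l (inverse d)" if "d \<noteq> 0" for d
    using that by (intro Q.inv_unique'[symmetric]) (simp_all add: qt_scalar_closed qt_scalar_mult qt_scalar_one)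
  then show ?thesis
    using assms by (auto simp: int_pow_def2 qt_scalar_nat_pow power_int_def power_inverse)
qed

lemma qt_f_diag: "qt_f q l z n n = qt_scalar q l (\<Prod>k=1..n. z k)"
  by (induction n) (simp_all add: qt_scalar_one qt_scalar_mult mult.commute)

lemma qt_f_step:
  assumes "1 \<le> i" "i \<le> n"
  shows "qt_f q l z (Suc n) i =
    qt_f q l z n i \<otimes>\<^bsub>qtorus q l\<^esub> qt_X q l n i \<oplus>\<^bsub>qtorus q l\<^esub>
      qt_scalar q l (z (Suc n)) \<otimes>\<^bsub>qtorus q l\<^esub> qt_f q l z n (i - 1) \<otimes>\<^bsub>qtorus q l\<^esub> qt_T q l n i"
  using assms by (cases i) auto

text \<open>The bound \<open>Suc l\<close> reflects that row \<open>n\<close> uses generators of row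
  \<open>n - 1\<close>, which exist only up to row \<open>l\<close>.\<close>

lemma qt_f_closed: "n \<le> Suc l \<Longrightarrow> i \<le> n \<Longrightarrow> qt_f q l z n i \<in> carrier (qtorus q l)"
proof (induction n arbitrary: i)
  interpret Q: ring "qtorus q l" by (rule ring_qtorus)
  { case 0
    then show ?case by simp
  next
    case (Suc n)
    consider "i = 0" | "i = Suc n" | "1 \<le> i" "i \<le> n" using Suc.prems by linarith
    then show ?case
    proof cases
      case 3
      then have "(n, i) \<in> qt_index l" using Suc.prems by (auto simp: qt_index_def)
      then show ?thesis unfolding qt_f_step[OF 3]
        using 3 Suc by (intro Q.add.m_closed Q.m_closed qt_X_closed qt_T_closed qt_scalar_closed) auto
    qed (auto simp: qt_f_diag qt_scalar_closed simp del: qt_f.simps(3)) }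
qed


section \<open>Representations\<close>

text \<open>The zero ring (the case of a trivial space) is not a \<open>ring_1\<close>, whence the sort
  \<open>{ring, monoid_mult}\<close> throughout.\<close>

typedef (overloaded) 'v additive_map =
  "{f :: 'v::ab_group_add \<Rightarrow> 'v. \<forall>x y. f (x + y) = f x + f y}"
  morphisms apply_map additive_map
  by (rule exI[of _ id]) simp

setup_lifting type_definition_additive_map

instantiation additive_map :: (ab_group_add) "{ring, monoid_mult}"
begin

lift_definition zero_additive_map :: "'a additive_map" is "\<lambda>_. 0" by simp
lift_definition one_additive_map :: "'a additive_map" is id by simp
lift_definition plus_additive_map :: "'a additive_map \<Rightarrow> 'a additive_map \<Rightarrow> 'a additive_map"
  is "\<lambda>f g x. f x + g x" by (simp add: algebra_simps)
lift_definition minus_additive_map :: "'a additive_map \<Rightarrow> 'a additive_map \<Rightarrow> 'a additive_map"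
  is "\<lambda>f g x. f x - g x" by (simp add: algebra_simps)
lift_definition uminus_additive_map :: "'a additive_map \<Rightarrow> 'a additive_map"
  is "\<lambda>f x. - f x" by simp
lift_definition times_additive_map :: "'a additive_map \<Rightarrow> 'a additive_map \<Rightarrow> 'a additive_map"
  is "(\<circ>)" by simp

instance
  by standard (transfer; simp add: fun_eq_iff algebra_simps)+

end

lemma linear_iff_scale_add:
  "Vector_Spaces.linear s1 s2 f \<longleftrightarrow> vector_space s1 \<and> vector_space s2 \<and>
    (\<forall>x y. f (x + y) = f x + f y) \<and> (\<forall>c x. f (s1 c x) = s2 c (f x))"
  unfolding Vector_Spaces.linear_def module_hom_def module_hom_axioms_def
    module_iff_vector_space by blast

section \<open>Operators of a representation in a type-class ring\<close>

locale qt_rep =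
  fixes q :: real and l :: nat and scale :: "complex \<Rightarrow> 'v::ab_group_add \<Rightarrow> 'v"
    and \<rho> :: "qt_word_alg set \<Rightarrow> 'v \<Rightarrow> 'v"
  assumes rep: "qt_representation q l scale \<rho>"
begin

sublocale Q: ring "qtorus q l" by (rule ring_qtorus)

text \<open>Passing from the carrier-based torus to \<open>additive_map\<close> gives access to the
  powers, finite sums and \<open>prod_list\<close> of the type classes. \<open>act\<close> is
  meaningful only on the carrier, whence the closure conditions below.\<close>

definition act :: "qt_word_alg set \<Rightarrow> 'v additive_map" where
  "act a = additive_map (\<rho> a)"

lemma hom: "\<rho> \<in> ring_hom (qtorus q l) (End_ring scale)"
  and rho_scalar: "\<rho> (qt_scalar q l c) = scale c"
  using rep by (auto simp: qt_representation_def)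

lemma apply_act:
  assumes "a \<in> carrier (qtorus q l)"
  shows "apply_map (act a) = \<rho> a"
proof -
  have "Vector_Spaces.linear scale scale (\<rho> a)"
    using ring_hom_closed[OF hom assms] by (simp add: End_ring_def)
  then show ?thesis
    unfolding act_def by (intro additive_map_inverse) (simp add: linear_iff_scale_add)
qed

lemma act_mult:
  assumes "a \<in> carrier (qtorus q l)" "b \<in> carrier (qtorus q l)"
  shows "act (a \<otimes>\<^bsub>qtorus q l\<^esub> b) = act a * act b"
proof -
  have "apply_map (act (a \<otimes>\<^bsub>qtorus q l\<^esub> b)) = apply_map (act a * act b)"
    using assms ring_hom_mult[OF hom assms] by (simp add: apply_act times_additive_map.rep_eq End_ring_def)
  then show ?thesis by (simp add: apply_map_inject)
qed

lemma act_add: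
  assumes "a \<in> carrier (qtorus q l)" "b \<in> carrier (qtorus q l)"
  shows "act (a \<oplus>\<^bsub>qtorus q l\<^esub> b) = act a + act b"
proof -
  have "apply_map (act (a \<oplus>\<^bsub>qtorus q l\<^esub> b)) = apply_map (act a + act b)"
    using assms ring_hom_add[OF hom assms] by (simp add: apply_act plus_additive_map.rep_eq End_ring_def)
  then show ?thesis by (simp add: apply_map_inject)
qed

lemma act_one: "act \<one>\<^bsub>qtorus q l\<^esub> = 1"
proof -
  have "apply_map (act \<one>\<^bsub>qtorus q l\<^esub>) = apply_map 1"
    using ring_hom_one[OF hom] by (simp add: apply_act one_additive_map.rep_eq End_ring_def)
  then show ?thesis by (simp add: apply_map_inject)
qed

lemma act_nat_pow: "a \<in> carrier (qtorus q l) \<Longrightarrow> act (a [^]\<^bsub>qtorus q l\<^esub> (n::nat)) = act a ^ n"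
  by (induction n) (simp_all add: act_one act_mult power_commutes)

lemma act_ordered_prod:
  "set xs \<subseteq> carrier (qtorus q l) \<Longrightarrow>
    ordered_prod (qtorus q l) xs \<in> carrier (qtorus q l) \<and>
    act (ordered_prod (qtorus q l) xs) = prod_list (map act xs)"
  by (induction xs) (auto simp: ordered_prod_def act_one act_mult)

lemma act_commutes:
  assumes "a \<otimes>\<^bsub>qtorus q l\<^esub> b = b \<otimes>\<^bsub>qtorus q l\<^esub> a" "a \<in> carrier (qtorus q l)" "b \<in> carrier (qtorus q l)"
  shows "commutes (act a) (act b)"
  unfolding commutes_def using assms by (simp flip: act_mult)

lemma act_scalar_add: "act (qt_scalar q l (c + d)) = act (qt_scalar q l c) + act (qt_scalar q l d)"
proof -
  have "vector_space scale" using rep by (simp add: qt_representation_def)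
  then have "scale (c + d) = (\<lambda>v. scale c v + scale d v)"
    by (simp add: vector_space_def fun_eq_iff)
  then have "apply_map (act (qt_scalar q l (c + d))) =
      apply_map (act (qt_scalar q l c) + act (qt_scalar q l d))"
    by (simp add: apply_act qt_scalar_closed rho_scalar plus_additive_map.rep_eq)
  then show ?thesis by (simp add: apply_map_inject)
qed

text \<open>A leftmost X acts last and is absorbed by \<open>v_minus\<close>; a rightmost T acts
  first and is absorbed by \<open>v_plus\<close>.\<close>

lemma whittaker_data:
  assumes "0 < q" "q < 1"
    and dual: "Vector_Spaces.linear scale (*) v_minus"
    and pairing: "v_minus v_plus = 1"
    and T_inv: "\<forall>i\<in>{1..l}. \<forall>k\<in>{1..i}. \<rho> (qt_T q l i k) v_plus = v_plus"
    and X_inv: "\<forall>i\<in>{1..l}. \<forall>k\<in>{1..i}. v_minus \<circ> \<rho> (qt_X q l i k) = v_minus"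
  shows "whittaker_data (\<lambda>c. act (qt_scalar q l c)) q l z (\<lambda>k i. act (qt_X q l k i))
    (\<lambda>k i. act (qt_T q l k i)) (\<lambda>n i. act (qt_f q l z n i)) (\<lambda>e. v_minus (apply_map e v_plus))"
proof unfold_locales
  note closed = qt_scalar_closed qt_X_closed qt_T_closed
  have X_inv': "v_minus (\<rho> (qt_X q l k i) v) = v_minus v" if "(k, i) \<in> qt_index l" for k i v
  proof -
    have "v_minus \<circ> \<rho> (qt_X q l k i) = v_minus" using X_inv that by (auto simp: qt_index_def)
    then show ?thesis by (metis comp_apply)
  qed
  \<comment> \<open>One relation serves two purposes: equal indices give the scalar q, different
    ones give exponent 0 and hence plain commutation.\<close>
  have T_X: "act (qt_T q l k i) * act (qt_X q l m j) =
      act (qt_scalar q l (of_real (q ^ (of_bool (k = m) * of_bool (i = j))))) *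
      act (qt_X q l m j) * act (qt_T q l k i)"
    if "(k, i) \<in> qt_index l" "(m, j) \<in> qt_index l" for k i m j
    using qt_T_X[OF that, of q] that by (simp only: act_mult[symmetric] closed Q.m_closed)
  show "act (qt_scalar q l (a + b)) = act (qt_scalar q l a) + act (qt_scalar q l b)" for a b
    by (rule act_scalar_add)
  show "act (qt_scalar q l (a * b)) = act (qt_scalar q l a) * act (qt_scalar q l b)" for a b
    by (simp add: closed qt_scalar_mult flip: act_mult)
  show "act (qt_scalar q l 1) = 1" by (simp add: qt_scalar_one act_one)
  show "0 < q" "q < 1" by fact+
  fix k i assume ki: "(k, i) \<in> qt_index l"
  show "commutes (act (qt_scalar q l c)) (act (qt_X q l k i))"
    and "commutes (act (qt_scalar q l c)) (act (qt_T q l k i))" for c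
    using ki by (auto intro!: act_commutes closed qt_scalar_X qt_scalar_T)
  show "act (qt_T q l k i) * act (qt_X q l k i) =
      act (qt_scalar q l (complex_of_real q)) * act (qt_X q l k i) * act (qt_T q l k i)"
    using T_X[OF ki ki] by simp
  show "v_minus (apply_map (act (qt_X q l k i) * a) v_plus) = v_minus (apply_map a v_plus)" for a
    using ki by (simp add: times_additive_map.rep_eq apply_act closed X_inv')
  show "v_minus (apply_map (a * act (qt_T q l k i)) v_plus) = v_minus (apply_map a v_plus)" for a
    using ki T_inv by (auto simp: times_additive_map.rep_eq apply_act closed qt_index_def)
  fix m j assume mj: "(m, j) \<in> qt_index l"
  show "commutes (act (qt_X q l k i)) (act (qt_X q l m j))"
    and "commutes (act (qt_T q l k i)) (act (qt_T q l m j))"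
    using ki mj by (auto intro!: act_commutes closed qt_X_commute qt_T_commute)
  show "commutes (act (qt_T q l k i)) (act (qt_X q l m j))" if "(k, i) \<noteq> (m, j)"
    unfolding commutes_def using T_X[OF ki mj] that by (auto simp: qt_scalar_one act_one)
next
  show "act (qt_f q l z n 0) = 1" for n by (simp add: act_one)
  fix n assume n: "n \<le> l"
  show "act (qt_f q l z (Suc n) (Suc n)) = act (qt_scalar q l (z (Suc n))) * act (qt_f q l z n n)"
    using n by (simp add: act_mult qt_scalar_closed qt_f_closed)
  fix i assume i: "1 \<le> i" "i \<le> n"
  then have ni: "(n, i) \<in> qt_index l" using n by (simp add: qt_index_def)
  show "act (qt_f q l z (Suc n) i) = act (qt_f q l z n i) * act (qt_X q l n i) +
      act (qt_scalar q l (z (Suc n))) * act (qt_f q l z n (i - 1)) * act (qt_T q l n i)"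
    unfolding qt_f_step[OF i] using i n ni
    by (simp add: act_add act_mult qt_scalar_closed qt_X_closed qt_T_closed qt_f_closed)
next
  have lin: "v_minus (x + y) = v_minus x + v_minus y" "v_minus (scale c x) = c * v_minus x" for x y c
    using dual by (auto simp: linear_iff_scale_add)
  show "v_minus (apply_map (a + b) v_plus) = v_minus (apply_map a v_plus) + v_minus (apply_map b v_plus)" for a b
    by (simp add: plus_additive_map.rep_eq lin)
  show "v_minus (apply_map (act (qt_scalar q l c) * a) v_plus) = c * v_minus (apply_map a v_plus)" for c a
    by (simp add: times_additive_map.rep_eq apply_act qt_scalar_closed rho_scalar lin)
  show "v_minus (apply_map 1 v_plus) = 1" by (simp add: one_additive_map.rep_eq pairing)
qed

end

theorem theorem4p1:
  fixes q :: real and l :: nat and p :: "nat \<Rightarrow> int" and z :: "nat \<Rightarrow> complex"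
    and scale :: "complex \<Rightarrow> 'v::ab_group_add \<Rightarrow> 'v"
    and \<rho> :: "qt_word_alg set \<Rightarrow> 'v \<Rightarrow> 'v"
    and v_plus :: 'v and v_minus :: "'v \<Rightarrow> complex"
  assumes "0 < q" and "q < 1" and "l \<ge> 1"
    and dominant: "\<forall>k\<in>{1..l}. p k \<ge> p (k+1)"
    and z_nonzero: "\<forall>k\<in>{1..l+1}. z k \<noteq> 0"
    and rep: "qt_representation q l scale \<rho>"
    and dual: "Vector_Spaces.linear scale (*) v_minus"
    and pairing: "v_minus v_plus = 1"
    and T_inv: "\<forall>i\<in>{1..l}. \<forall>k\<in>{1..i}. \<rho> (qt_T q l i k) v_plus = v_plus"
    and X_inv: "\<forall>i\<in>{1..l}. \<forall>k\<in>{1..i}. v_minus \<circ> \<rho> (qt_X q l i k) = v_minus"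
  shows "q_whittaker_normalized q l z p =
    v_minus (\<rho> (ordered_prod (qtorus q l)
      (map (\<lambda>k. qt_f q l z (l+1) k [^]\<^bsub>qtorus q l\<^esub>
                  (p k - (if k = l + 1 then 0 else p (k+1)))) [1..<l+2])) v_plus)"
proof -
  interpret qt_rep q l scale \<rho> by (rule qt_rep.intro[OF rep])
  interpret whittaker_data "\<lambda>c. act (qt_scalar q l c)" q l z "\<lambda>k i. act (qt_X q l k i)"
    "\<lambda>k i. act (qt_T q l k i)" "\<lambda>n i. act (qt_f q l z n i)" "\<lambda>e. v_minus (apply_map e v_plus)"
    by (rule whittaker_data) fact+
  let ?Z = "\<Prod>k=1..l+1. z k"
  let ?g = "\<lambda>k. qt_f q l z (l+1) k [^]\<^bsub>qtorus q l\<^esub> (p k - (if k = l + 1 then 0 else p (k+1)))"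
  have Z: "?Z \<noteq> 0" using z_nonzero by auto
  have f: "qt_f q l z (l+1) k \<in> carrier (qtorus q l)" if "k \<le> l + 1" for k
    using that by (intro qt_f_closed) auto
  \<comment> \<open>Dominance makes these exponents nonnegative, so only the last factor can carry a
    negative one.\<close>
  have g: "?g k = qt_f q l z (l+1) k [^]\<^bsub>qtorus q l\<^esub> nat (p k - p (k+1))" if "k \<in> {1..l}" for k
    using that dominant by (simp add: int_pow_def2)
  \<comment> \<open>The last factor is a nonzero scalar, so its integer power is computed in the
    complex numbers.\<close>
  have g_last: "?g (l+1) = qt_scalar q l (?Z powi p (l+1))"
    unfolding qt_f_diag using qt_scalar_int_pow[OF Z] by simp
  have g_closed: "?g k \<in> carrier (qtorus q l)" if "k \<in> {1..l+1}" for k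
  proof (cases "k = l + 1")
    case True
    show ?thesis unfolding True g_last by (rule qt_scalar_closed)
  next
    case False
    then have "k \<in> {1..l}" using that by auto
    then show ?thesis using f unfolding g[OF \<open>k \<in> {1..l}\<close>] by auto
  qed
  have "set [1..<l+2] = {1..l+1}" by auto
  then have closed: "set (map ?g [1..<l+2]) \<subseteq> carrier (qtorus q l)"
    unfolding set_map using g_closed by blast
  have "prod_list (map act (map ?g [1..<l+2])) =
      prod_list (map (act \<circ> ?g) [1..<l+1]) * act (?g (l+1))" by simp
  also have "prod_list (map (act \<circ> ?g) [1..<l+1]) = F_monomial (l+1) p"
    unfolding F_monomial_def
  proof (intro arg_cong[where f = prod_list] map_cong refl)
    fix k assume "k \<in> set [1..<l+1]"
    then have k: "k \<in> {1..l}" by auto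
    then show "(act \<circ> ?g) k = act (qt_f q l z (l+1) k) ^ nat (p k - p (k+1))"
      using f[of k] unfolding comp_apply g[OF k] by (simp add: act_nat_pow)
  qed
  \<comment> \<open>The scalar stands last in the ordered product and is moved to the front, where
    \<open>\<phi>_s\<close> takes it out of the matrix element.\<close>
  also have "F_monomial (l+1) p * act (?g (l+1)) = act (qt_scalar q l (?Z powi p (l+1))) * F_monomial (l+1) p"
  proof -
    have "commutes (act (qt_scalar q l c)) (F_monomial (l+1) p)" for c
      unfolding F_monomial_def by (intro commutes_prod_list) (auto intro!: commutes_power s_F)
    then show ?thesis unfolding g_last by (simp add: commutes_def)
  qed
  finally have act_prod: "act (ordered_prod (qtorus q l) (map ?g [1..<l+2])) =
      act (qt_scalar q l (?Z powi p (l+1))) * F_monomial (l+1) p"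
    by (simp only: act_ordered_prod[OF closed])
  have "v_minus (\<rho> (ordered_prod (qtorus q l) (map ?g [1..<l+2])) v_plus) =
      v_minus (apply_map (act (ordered_prod (qtorus q l) (map ?g [1..<l+2]))) v_plus)"
    by (simp only: apply_act[OF conjunct1[OF act_ordered_prod[OF closed]]])
  also have "\<dots> = ?Z powi p (l+1) * v_minus (apply_map (F_monomial (l+1) p) v_plus)"
    unfolding act_prod by (rule \<phi>_s)
  also have "\<dots> = (\<Sum>P\<in>gt_patterns l p. gt_weight q z l P)"
    using dominant z_nonzero by (intro matrix_element_F_monomial) auto
  also have "\<dots> = q_whittaker_normalized q l z p"
    using assms(1-3) by (rule q_whittaker_normalized_eq[symmetric])
  finally show ?thesis ..
qed

end
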